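(* Suppose a network admits a layerwise decomposition $\mathcal{N}=\mathcal{N}_L\circ\cdots\circ\mathcal{N}_1$ with spectrally analytic layer propagation maps $F_\ell:=\mathcal{E}_{\mathcal{N}_\ell}$. Define $A_0:=A_{\mathrm{in}}$, $A_\ell:=F_\ell(A_{\ell-1})$ for $1\le\ell\le L$, and $\mathcal{S}_\ell:=\partial^{\mathrm{spec}}F_\ell(A_{\ell-1})$. Assume: 1. each $\mathcal{S}_\ell$ is a bounded linear operator on the relevant Banach spectral state space; 2. there exist constants $c_\ell<1$ with $\|\mathcal{S}_\ell\|\le c_\ell$ for $1\le\ell\le L$; 3. $\sum_{\ell=1}^{L-1}\|\mathcal{I}_{\ell,\ell+1}\|<\infty$, where $\mathcal{I}_{\ell,\ell+1}$ is the interlayer interface residue generated by coupling adjacent layers. Then the global first-order spectral sensitivity operator $\mathcal{S}_{\mathcal{N}}:=\partial^{\mathrm{spec}}F_{\mathcal{N}}(A_0)$, with $F_{\mathcal{N}}:=F_L\circ\cdots\circ F_1$, satisfies $$\|\mathcal{S}_{\mathcal{N}}\|\le\prod_{\ell=1}^{L}c_\ell.$$ In particular, if there is a uniform constant $c<1$ with $c_\ell\le c$ for all $\ell$, then perturbations decay exponentially with depth: $$\|\delta A_{\mathrm{out}}\|\le c^L\,\|\delta A_{\mathrm{in}}\|.$$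
   Context: **Layerwise decomposition.** The network is a sequential composition of subnetworks (layers) with matching interfaces whose evaluation maps satisfy $\mathcal{E}_{\mathcal{N}}=\mathcal{E}_{\mathcal{N}_L}\circ\cdots\circ\mathcal{E}_{\mathcal{N}_1}$; $\mathcal{E}_{\mathcal{N}_\ell}$ is the map from input spectral state to output spectral state of layer $\ell$, between Banach spaces (spectral state spaces). **Spectral analyticity and derivative.** $F_\ell$ has at each relevant point a locally convergent Taylor expansion $F_\ell(A+\delta A)=F_\ell(A)+\sum_{k\ge1}\frac1{k!}\partial_k^{\mathrm{spec}}F_\ell(A)[\delta A^{\otimes k}]$ with bounded $k$-multilinear coefficients; $\partial^{\mathrm{spec}}=\partial_1^{\mathrm{spec}}$, which obeys the chain rule. **Interface residues.** $\mathcal{I}_{\ell,\ell+1}$ is an element of a normed space recording spectral content generated by coupling layers $\ell$ and $\ell+1$ (a notion from the author's earlier work). **Perturbations.** $\delta A_{\mathrm{in}}$ is an input perturbation and $\delta A_{\mathrm{out}}=\mathcal{S}_{\mathcal{N}}(\delta A_{\mathrm{in}})$ is the linearized output perturbation. *)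

theory Defs
  imports "HOL-Analysis.Analysis"
begin

text \<open>
  The state spaces of the layers may all be different. They are rendered as closed subspaces
  of one ambient Banach space. Every finite family of Banach spaces occurs in this way up to
  isometry, as the summands of its direct sum. Only vectors of the subspaces, and the values of
  maps on them, are ever constrained. Scalars are real; a complex Banach space is covered via its
  underlying real one, which has the same operator norms.
\<close>

definition banach_subspace :: "'a::banach set \<Rightarrow> bool" where
  "banach_subspace X \<longleftrightarrow> subspace X \<and> closed X"

definition bounded_linear_on ::
  "'a::real_normed_vector set \<Rightarrow> 'a set \<Rightarrow> ('a \<Rightarrow> 'a) \<Rightarrow> bool" where
  "bounded_linear_on X Y T \<longleftrightarrow>
     T \<in> X \<rightarrow> Y \<and>
     (\<forall>x\<in>X. \<forall>y\<in>X. T (x + y) = T x + T y) \<and>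
     (\<forall>a. \<forall>x\<in>X. T (a *\<^sub>R x) = a *\<^sub>R T x) \<and>
     (\<exists>K. \<forall>x\<in>X. norm (T x) \<le> K * norm x)"

text \<open>The relativised form of \<^const>\<open>onorm\<close>, with which it agrees for \<open>X = UNIV\<close>.\<close>

definition onorm_on :: "'a::real_normed_vector set \<Rightarrow> ('a \<Rightarrow> 'a) \<Rightarrow> real" where
  "onorm_on X T = (SUP x\<in>X. norm (T x) / norm x)"

text \<open>A \<open>k\<close>-linear map is a function on argument lists of length \<open>k\<close>.\<close>

definition bounded_multilinear_on ::
  "nat \<Rightarrow> 'a::real_normed_vector set \<Rightarrow> 'a set \<Rightarrow> ('a list \<Rightarrow> 'a) \<Rightarrow> bool" where
  "bounded_multilinear_on k X Y M \<longleftrightarrow>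
     (\<forall>xs\<in>lists X. length xs = k \<longrightarrow> M xs \<in> Y) \<and>
     (\<forall>xs\<in>lists X. \<forall>i<k. \<forall>x\<in>X. \<forall>y\<in>X. length xs = k \<longrightarrow>
        M (xs[i := x + y]) = M (xs[i := x]) + M (xs[i := y])) \<and>
     (\<forall>xs\<in>lists X. \<forall>i<k. \<forall>a. \<forall>x\<in>X. length xs = k \<longrightarrow>
        M (xs[i := a *\<^sub>R x]) = a *\<^sub>R M (xs[i := x])) \<and>
     (\<exists>K. \<forall>xs\<in>lists X. length xs = k \<longrightarrow> norm (M xs) \<le> K * (\<Prod>x\<leftarrow>xs. norm x))"

text \<open>
  \<open>F (A + h) = F A + (\<Sum>k\<ge>1. D k [h, \<dots>, h] / k!)\<close> for all small \<open>h \<in> X\<close>;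
  the summation index is shifted by one. \<open>D 0\<close> is irrelevant.
\<close>

definition has_spectral_taylor ::
  "'a::real_normed_vector set \<Rightarrow> 'a set \<Rightarrow> ('a \<Rightarrow> 'a) \<Rightarrow> 'a \<Rightarrow> (nat \<Rightarrow> 'a list \<Rightarrow> 'a) \<Rightarrow> bool" where
  "has_spectral_taylor X Y F A D \<longleftrightarrow>
     (\<forall>k\<ge>1. bounded_multilinear_on k X Y (D k)) \<and>
     (\<exists>r>0. \<forall>h\<in>X. norm h < r \<longrightarrow>
        (\<lambda>k. (1 / fact (Suc k)) *\<^sub>R D (Suc k) (replicate (Suc k) h)) sums (F (A + h) - F A))"

definition spectrally_analytic_at ::
  "'a::real_normed_vector set \<Rightarrow> 'a set \<Rightarrow> ('a \<Rightarrow> 'a) \<Rightarrow> 'a \<Rightarrow> bool" where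
  "spectrally_analytic_at X Y F A \<longleftrightarrow> (\<exists>D. has_spectral_taylor X Y F A D)"

text \<open>
  The first-order Taylor coefficient, as a function of the direction \<open>h\<close>. It is chosen
  pointwise because coefficients are determined only on \<open>X\<close>.
\<close>

definition spec_deriv ::
  "'a::real_normed_vector set \<Rightarrow> 'a set \<Rightarrow> ('a \<Rightarrow> 'a) \<Rightarrow> 'a \<Rightarrow> 'a \<Rightarrow> 'a" where
  "spec_deriv X Y F A h = (THE y. \<exists>D. has_spectral_taylor X Y F A D \<and> y = D 1 [h])"

text \<open>\<open>layer_comp F L = F L \<circ> \<dots> \<circ> F 1\<close>\<close>

primrec layer_comp :: "(nat \<Rightarrow> 'a \<Rightarrow> 'a) \<Rightarrow> nat \<Rightarrow> 'a \<Rightarrow> 'a" where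
  "layer_comp F 0 = id"
| "layer_comp F (Suc n) = F (Suc n) \<circ> layer_comp F n"

text \<open>
  Layer \<open>l\<close> takes states in \<open>X (l - 1)\<close> to states in \<open>X l\<close>, for \<open>1 \<le> l \<le> L\<close>. Networks form an
  arbitrary type, on which only the evaluation map is given.
\<close>

definition layerwise_decomposition ::
  "('net \<Rightarrow> 'a::banach \<Rightarrow> 'a) \<Rightarrow> (nat \<Rightarrow> 'a set) \<Rightarrow> 'net \<Rightarrow> (nat \<Rightarrow> 'net) \<Rightarrow> nat \<Rightarrow> bool" where
  "layerwise_decomposition eval_net X N layer L \<longleftrightarrow>
     (\<forall>l\<le>L. banach_subspace (X l)) \<and>
     (\<forall>l\<in>{1..L}. eval_net (layer l) \<in> X (l - 1) \<rightarrow> X l) \<and>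
     (\<forall>A\<in>X 0. eval_net N A = layer_comp (\<lambda>l. eval_net (layer l)) L A)"

end

theory Submission
  imports Defs "HOL-Combinatorics.Multiset_Permutations"
begin

text \<open>
  The operator norm bound follows by induction over the layers from the chain rule, so the work
  is to show that a composition of spectrally analytic maps is spectrally analytic; otherwise
  \<^const>\<open>spec_deriv\<close> of the whole network would be a description of nothing.

  Convergence of a Taylor series is only assumed pointwise and only constrains the values of the
  coefficients on the diagonal. After passing to symmetrized coefficients, the Baire category
  theorem bounds \<open>D k [u, \<dots>, u] / k!\<close> by \<open>N ^ k\<close> for all \<open>u\<close> in some ball, and polarization
  based at the centre of that ball turns this into \<open>norm (D k xs) \<le> k! * C ^ k * (\<Prod>x\<leftarrow>xs. norm x)\<close>.
  With such geometric bounds the double series obtained by substituting one expansion into the other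
  converges absolutely for small arguments and may be regrouped by total degree.
\<close>

subsection \<open>Linear and multilinear maps on subspaces\<close>

text \<open>The boundedness constant of \<open>D k\<close> may depend on \<open>k\<close> in any
  way, and the coefficients are not unique: adding a bounded alternating bilinear form to
  \<open>D 2\<close> leaves the series unchanged. So no growth bound can hold for arbitrary
  coefficients, whereas inserting one series into another creates mixed terms off the diagonal whose
  summation needs such a bound. Symmetrization removes the ambiguity, since a symmetric multilinear
  map is determined by its diagonal. Baire yields a ball somewhere in the space, not necessarily
  around \<open>0\<close>; this is why the polarization formula has a base point that cancels. Its
  arguments must be shrunk to size of order \<open>1 / k\<close> to stay in the ball, which costs a
  factor \<open>k ^ k\<close>. This is affordable because \<open>k ^ k\<close> is at most
  \<open>k!\<close> times \<open>exp k\<close>, and the Taylor series divides by \<open>k!\<close>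
  anyway. Uniqueness of the first-order coefficient, needed for the definite description in
  \<open>spec_deriv\<close>, comes from identifying it with a one-sided directional
  derivative.\<close>

lemma bounded_linear_on_diff:
  assumes "bounded_linear_on X Y T" "subspace X" "x \<in> X" "y \<in> X"
  shows "T (x - y) = T x - T y"
proof -
  have "T (x + (-1) *\<^sub>R y) = T x + T ((-1) *\<^sub>R y)"
    using assms subspace_scale[of X y "-1"] unfolding bounded_linear_on_def by blast
  also have "T ((-1) *\<^sub>R y) = (-1) *\<^sub>R T y"
    using assms unfolding bounded_linear_on_def by blast
  finally show ?thesis by simp
qed

lemma bounded_linear_on_zero:
  assumes "bounded_linear_on X Y T" "subspace X"
  shows "T 0 = 0"
  using bounded_linear_on_diff[OF assms, of 0 0] assms by (simp add: subspace_0)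

lemma bounded_linear_on_bound:
  assumes "bounded_linear_on X Y T"
  obtains K where "K \<ge> 0" "\<And>x. x \<in> X \<Longrightarrow> norm (T x) \<le> K * norm x"
proof -
  obtain K where K: "\<And>x. x \<in> X \<Longrightarrow> norm (T x) \<le> K * norm x"
    using assms unfolding bounded_linear_on_def by blast
  have "norm (T x) \<le> max K 0 * norm x" if "x \<in> X" for x
    using K[OF that] mult_right_mono[of K "max K 0" "norm x"] by simp
  then show ?thesis using that[of "max K 0"] by simp
qed

lemma bounded_linear_on_tendsto:
  assumes T: "bounded_linear_on X Y T" and X: "subspace X"
    and f: "eventually (\<lambda>i. f i \<in> X) G" "(f \<longlongrightarrow> s) G" and s: "s \<in> X"
  shows "((\<lambda>i. T (f i)) \<longlongrightarrow> T s) G"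
proof -
  obtain K where K: "\<And>x. x \<in> X \<Longrightarrow> norm (T x) \<le> K * norm x"
    using bounded_linear_on_bound[OF T] by blast
  have "((\<lambda>i. K * norm (f i - s)) \<longlongrightarrow> K * norm (s - s)) G"
    by (intro tendsto_intros f)
  then have lim: "((\<lambda>i. K * norm (f i - s)) \<longlongrightarrow> 0) G"
    by simp
  have "\<forall>\<^sub>F i in G. norm (T (f i) - T s) \<le> K * norm (f i - s)"
    using f(1)
  proof eventually_elim
    case (elim i)
    have "T (f i) - T s = T (f i - s)"
      using bounded_linear_on_diff[OF T X elim s] by simp
    then show ?case using K[OF subspace_diff[OF X elim s]] by simp
  qed
  then have "((\<lambda>i. T (f i) - T s) \<longlongrightarrow> 0) G"
    by (rule Lim_null_comparison[OF _ lim])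
  then show ?thesis by (rule LIM_zero_cancel)
qed

lemma bounded_linear_on_has_sum:
  assumes T: "bounded_linear_on X Y T" and X: "subspace X"
    and f: "\<And>i. i \<in> J \<Longrightarrow> f i \<in> X" "(f has_sum s) J" and s: "s \<in> X"
  shows "((\<lambda>i. T (f i)) has_sum T s) J"
proof -
  have sum_T: "T (sum f I) = (\<Sum>i\<in>I. T (f i))" if "finite I" "I \<subseteq> J" for I
    using that
  proof (induction I rule: finite_induct)
    case empty
    then show ?case using bounded_linear_on_zero[OF T X] by simp
  next
    case (insert i I)
    have "f i \<in> X" "sum f I \<in> X"
      using insert.prems f(1) X by (auto intro!: subspace_sum)
    then have "T (f i + sum f I) = T (f i) + T (sum f I)"
      using T unfolding bounded_linear_on_def by blast
    then show ?case using insert by simp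
  qed
  have "\<forall>\<^sub>F I in finite_subsets_at_top J. sum f I \<in> X"
    by (rule eventually_finite_subsets_at_top_weakI) (use f(1) X in \<open>auto intro!: subspace_sum\<close>)
  then have "((\<lambda>I. T (sum f I)) \<longlongrightarrow> T s) (finite_subsets_at_top J)"
    using f(2) s unfolding has_sum_def by (rule bounded_linear_on_tendsto[OF T X])
  moreover have "\<forall>\<^sub>F I in finite_subsets_at_top J. T (sum f I) = (\<Sum>i\<in>I. T (f i))"
    by (rule eventually_finite_subsets_at_top_weakI) (rule sum_T)
  ultimately show ?thesis
    unfolding has_sum_def by (rule Lim_transform_eventually)
qed

lemma bounded_multilinear_on_range:
  "bounded_multilinear_on k X Y M \<Longrightarrow> xs \<in> lists X \<Longrightarrow> length xs = k \<Longrightarrow> M xs \<in> Y"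
  by (simp add: bounded_multilinear_on_def)

lemma bounded_multilinear_on_bound:
  assumes "bounded_multilinear_on k X Y M"
  obtains K where "K \<ge> 0"
    "\<And>xs. xs \<in> lists X \<Longrightarrow> length xs = k \<Longrightarrow> norm (M xs) \<le> K * (\<Prod>x\<leftarrow>xs. norm x)"
proof -
  have "\<exists>K. \<forall>xs\<in>lists X. length xs = k \<longrightarrow> norm (M xs) \<le> K * (\<Prod>x\<leftarrow>xs. norm x)"
    using assms unfolding bounded_multilinear_on_def by (elim conjE)
  then obtain K where K: "\<And>xs. xs \<in> lists X \<Longrightarrow> length xs = k \<Longrightarrow> norm (M xs) \<le> K * (\<Prod>x\<leftarrow>xs. norm x)"
    by blast
  have "norm (M xs) \<le> max K 0 * (\<Prod>x\<leftarrow>xs. norm x)" if "xs \<in> lists X" "length xs = k" for xs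
  proof -
    have "0 \<le> (\<Prod>x\<leftarrow>xs. norm x)" by (rule prod_list_nonneg) auto
    then show ?thesis
      using K[OF that] mult_right_mono[of K "max K 0" "\<Prod>x\<leftarrow>xs. norm x"] by simp
  qed
  then show ?thesis using that[of "max K 0"] by simp
qed

text \<open>Freezing all arguments but one reduces the inductions over slots to facts about linear
  maps; the split \<open>ys @ x # zs\<close> suits them better than the list updates of the
  definition.\<close>

lemma bounded_multilinear_on_slot:
  assumes M: "bounded_multilinear_on k X Y M"
    and ys: "ys \<in> lists X" and zs: "zs \<in> lists X" and k: "length ys + Suc (length zs) = k"
  shows "bounded_linear_on X Y (\<lambda>x. M (ys @ x # zs))"
proof -
  have upd: "(ys @ w # zs)[length ys := x] = ys @ x # zs" for w x by simp
  have *: "ys @ w # zs \<in> lists X" "length (ys @ w # zs) = k" "length ys < k" if "w \<in> X" for w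
    using that ys zs k by auto
  obtain K where K: "\<And>xs. xs \<in> lists X \<Longrightarrow> length xs = k \<Longrightarrow> norm (M xs) \<le> K * (\<Prod>x\<leftarrow>xs. norm x)"
    using bounded_multilinear_on_bound[OF M] by blast
  have "norm (M (ys @ x # zs)) \<le> (K * (\<Prod>x\<leftarrow>ys @ zs. norm x)) * norm x" if "x \<in> X" for x
    using K[OF *(1,2)[OF that]] by (simp add: mult_ac)
  moreover have "M (ys @ (x + y) # zs) = M (ys @ x # zs) + M (ys @ y # zs)" if "x \<in> X" "y \<in> X" for x y
    using M *[OF that(1)] that unfolding bounded_multilinear_on_def by (metis upd)
  moreover have "M (ys @ (a *\<^sub>R x) # zs) = a *\<^sub>R M (ys @ x # zs)" if "x \<in> X" for a x
    using M *[OF that(1)] that unfolding bounded_multilinear_on_def by (metis upd)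
  moreover have "M (ys @ x # zs) \<in> Y" if "x \<in> X" for x
    using bounded_multilinear_on_range[OF M *(1,2)[OF that]] .
  ultimately show ?thesis
    unfolding bounded_linear_on_def by blast
qed

lemma bounded_multilinear_on_sum:
  assumes Y: "subspace Y" and M: "\<And>i. i \<in> I \<Longrightarrow> bounded_multilinear_on k X Y (M i)"
  shows "bounded_multilinear_on k X Y (\<lambda>xs. \<Sum>i\<in>I. M i xs)"
proof -
  have "\<exists>K. \<forall>i\<in>I. \<forall>xs\<in>lists X. length xs = k \<longrightarrow> norm (M i xs) \<le> K i * (\<Prod>x\<leftarrow>xs. norm x)"
    using M unfolding bounded_multilinear_on_def by metis
  then obtain K where K: "\<And>i xs. i \<in> I \<Longrightarrow> xs \<in> lists X \<Longrightarrow> length xs = k \<Longrightarrow>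
      norm (M i xs) \<le> K i * (\<Prod>x\<leftarrow>xs. norm x)" by blast
  have "norm (\<Sum>i\<in>I. M i xs) \<le> sum K I * (\<Prod>x\<leftarrow>xs. norm x)" if "xs \<in> lists X" "length xs = k" for xs
    unfolding sum_distrib_right by (rule sum_norm_le) (rule K[OF _ that])
  then have bound: "\<exists>K. \<forall>xs\<in>lists X. length xs = k \<longrightarrow> norm (\<Sum>i\<in>I. M i xs) \<le> K * (\<Prod>x\<leftarrow>xs. norm x)"
    by blast
  have "(\<Sum>i\<in>I. M i xs) \<in> Y" if "xs \<in> lists X" "length xs = k" for xs
    by (rule subspace_sum[OF Y]) (rule bounded_multilinear_on_range[OF M that])
  moreover have "(\<Sum>i\<in>I. M i (xs[j := x + y])) = (\<Sum>i\<in>I. M i (xs[j := x])) + (\<Sum>i\<in>I. M i (xs[j := y]))"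
    if "xs \<in> lists X" "j < k" "x \<in> X" "y \<in> X" "length xs = k" for xs j x y
    unfolding sum.distrib[symmetric]
    by (rule sum.cong[OF refl]) (use M that in \<open>unfold bounded_multilinear_on_def, blast\<close>)
  moreover have "(\<Sum>i\<in>I. M i (xs[j := a *\<^sub>R x])) = a *\<^sub>R (\<Sum>i\<in>I. M i (xs[j := x]))"
    if "xs \<in> lists X" "j < k" "x \<in> X" "length xs = k" for xs j a x
    unfolding scaleR_sum_right
    by (rule sum.cong[OF refl]) (use M that in \<open>unfold bounded_multilinear_on_def, blast\<close>)
  ultimately show ?thesis
    using bound unfolding bounded_multilinear_on_def by simp
qed

lemma bounded_multilinear_on_scaleR:
  assumes Y: "subspace Y" and M: "bounded_multilinear_on k X Y M"
  shows "bounded_multilinear_on k X Y (\<lambda>xs. a *\<^sub>R M xs)"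
proof -
  obtain K where K: "\<And>xs. xs \<in> lists X \<Longrightarrow> length xs = k \<Longrightarrow> norm (M xs) \<le> K * (\<Prod>x\<leftarrow>xs. norm x)"
    using bounded_multilinear_on_bound[OF M] by blast
  have "norm (a *\<^sub>R M xs) \<le> (\<bar>a\<bar> * K) * (\<Prod>x\<leftarrow>xs. norm x)" if "xs \<in> lists X" "length xs = k" for xs
    using mult_left_mono[OF K[OF that], of "\<bar>a\<bar>"] by (simp add: mult_ac)
  then have "\<exists>K. \<forall>xs\<in>lists X. length xs = k \<longrightarrow> norm (a *\<^sub>R M xs) \<le> K * (\<Prod>x\<leftarrow>xs. norm x)"
    by blast
  then show ?thesis
    using M Y unfolding bounded_multilinear_on_def
    by (simp add: scaleR_add_right subspace_scale mult.commute)
qed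

text \<open>The factor may depend on the vector, so that this serves both for homogeneity of the
  diagonal (constant \<open>c\<close>) and for rescaling every argument to a prescribed
  norm.\<close>

lemma bounded_multilinear_on_scale_all:
  assumes M: "bounded_multilinear_on k X Y M" and X: "subspace X"
    and xs: "xs \<in> lists X" "length xs = k"
  shows "M (map (\<lambda>x. c x *\<^sub>R x) xs) = prod_list (map c xs) *\<^sub>R M xs"
proof -
  have "M (ys @ map (\<lambda>x. c x *\<^sub>R x) zs) = prod_list (map c zs) *\<^sub>R M (ys @ zs)"
    if "ys \<in> lists X" "zs \<in> lists X" "length ys + length zs = k" for ys zs
    using that
  proof (induction zs arbitrary: ys)
    case Nil
    then show ?case by simp
  next
    case (Cons z zs)
    have zs: "map (\<lambda>x. c x *\<^sub>R x) zs \<in> lists X"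
      using Cons.prems by (auto intro!: subspace_scale[OF X])
    have "bounded_linear_on X Y (\<lambda>x. M (ys @ x # zs))"
      by (rule bounded_multilinear_on_slot[OF M]) (use Cons.prems zs in auto)
    then have "M (ys @ (c z *\<^sub>R z) # zs) = c z *\<^sub>R M (ys @ z # zs)"
      using Cons.prems unfolding bounded_linear_on_def by auto
    moreover have "M ((ys @ [c z *\<^sub>R z]) @ map (\<lambda>x. c x *\<^sub>R x) zs) =
        prod_list (map c zs) *\<^sub>R M ((ys @ [c z *\<^sub>R z]) @ zs)"
      by (rule Cons.IH) (use Cons.prems in \<open>auto intro!: subspace_scale[OF X]\<close>)
    ultimately show ?case by (simp add: mult.commute)
  qed
  from this[of "[]" xs] xs show ?thesis by simp
qed

section \<open>Infinite sums over lists of indices\<close>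

lemma has_sum_lists_Suc:
  "(f has_sum s) {js. set js \<subseteq> J \<and> length js = Suc k} \<longleftrightarrow>
    ((\<lambda>(j, js). f (j # js)) has_sum s) (J \<times> {js. set js \<subseteq> J \<and> length js = k})"
proof -
  have "bij_betw (\<lambda>(j, js). j # js) (J \<times> {js. set js \<subseteq> J \<and> length js = k})
      {js. set js \<subseteq> J \<and> length js = Suc k}"
    by (rule bij_betwI[of _ _ _ "\<lambda>js. (hd js, tl js)"]) (auto simp: length_Suc_conv)
  from has_sum_reindex_bij_betw[OF this, of f s] show ?thesis
    by (simp add: case_prod_unfold)
qed

text \<open>Induction on \<open>k\<close> by splitting off the head. Nonnegativity makes convergence
  of the iterated sum sufficient for summability over the product.\<close>

lemma has_sum_prod_list:
  fixes b :: "'i \<Rightarrow> real"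
  assumes b: "(b has_sum s) J" and nonneg: "\<And>j. j \<in> J \<Longrightarrow> b j \<ge> 0"
  shows "((\<lambda>js. prod_list (map b js)) has_sum s ^ k) {js. set js \<subseteq> J \<and> length js = k}"
proof (induction k)
  case 0
  have "{js. set js \<subseteq> J \<and> length js = 0} = {[]}" by auto
  then show ?case by (simp add: has_sum_finite_iff)
next
  case (Suc k)
  let ?B = "{js. set js \<subseteq> J \<and> length js = k}"
  let ?f = "\<lambda>(j, js). b j * prod_list (map b js)"
  have inner: "((\<lambda>js. ?f (j, js)) has_sum b j * s ^ k) ?B" for j
    using has_sum_cmult_right[OF Suc] by simp
  have outer: "((\<lambda>j. b j * s ^ k) has_sum s * s ^ k) J"
    by (rule has_sum_cmult_left[OF b])
  have nn: "0 \<le> ?f x" if "x \<in> J \<times> ?B" for x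
    using that nonneg by (fastforce intro!: mult_nonneg_nonneg prod_list_nonneg)
  have "?f summable_on (J \<times> ?B)"
    by (rule summable_on_SigmaI[OF inner has_sum_imp_summable[OF outer]]) (use nn in auto)
  then have "(?f has_sum s * s ^ k) (J \<times> ?B)"
    by (rule has_sum_SigmaI[OF inner outer])
  then show ?case by (simp add: has_sum_lists_Suc)
qed

text \<open>Multiplying out one slot at a time; the iterated sums merge by comparison with the
  product of \<open>k\<close> copies of the series of norms. With finite \<open>J\<close> this is
  the multinomial expansion behind polarization.\<close>

lemma bounded_multilinear_on_has_sum:
  fixes X :: "'a::banach set"
  assumes M: "bounded_multilinear_on k X Y M" and X: "subspace X" and u: "u \<in> X"
    and z: "\<And>j. j \<in> J \<Longrightarrow> z j \<in> X" "(z has_sum u) J" "(\<lambda>j. norm (z j)) summable_on J"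
  shows "((\<lambda>js. M (map z js)) has_sum M (replicate k u)) {js. set js \<subseteq> J \<and> length js = k}"
proof -
  obtain K where K: "\<And>xs. xs \<in> lists X \<Longrightarrow> length xs = k \<Longrightarrow> norm (M xs) \<le> K * (\<Prod>x\<leftarrow>xs. norm x)"
    using bounded_multilinear_on_bound[OF M] by blast
  let ?n = "infsum (\<lambda>j. norm (z j)) J"
  \<comment> \<open>\<open>ys\<close> holds the summands already chosen in the leading slots; the
    induction expands the remaining \<open>l\<close> slots.\<close>
  have "((\<lambda>js. M (ys @ map z js)) has_sum M (ys @ replicate l u)) {js. set js \<subseteq> J \<and> length js = l}"
    if "ys \<in> lists X" "length ys + l = k" for ys l
    using that
  proof (induction l arbitrary: ys)
    case 0
    have "{js. set js \<subseteq> J \<and> length js = 0} = {[]}" by auto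
    then show ?case by (simp add: has_sum_finite_iff)
  next
    case (Suc l)
    let ?B = "{js. set js \<subseteq> J \<and> length js = l}"
    let ?f = "\<lambda>(j, js). M (ys @ z j # map z js)"
    have inner: "((\<lambda>js. ?f (j, js)) has_sum M (ys @ z j # replicate l u)) ?B" if "j \<in> J" for j
      using Suc.IH[of "ys @ [z j]"] Suc.prems z(1)[OF that] by simp
    have "bounded_linear_on X Y (\<lambda>x. M (ys @ x # replicate l u))"
      by (rule bounded_multilinear_on_slot[OF M]) (use Suc.prems u in auto)
    then have outer: "((\<lambda>j. M (ys @ z j # replicate l u)) has_sum M (ys @ u # replicate l u)) J"
      by (rule bounded_linear_on_has_sum[OF _ X]) (use z u in auto)
    have "((\<lambda>js. prod_list (map (\<lambda>j. norm (z j)) js)) has_sum ?n ^ Suc l) {js. set js \<subseteq> J \<and> length js = Suc l}"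
      by (rule has_sum_prod_list[OF has_sum_infsum[OF z(3)]]) simp
    then have "(\<lambda>(j, js). prod_list (map (\<lambda>j. norm (z j)) (j # js))) summable_on (J \<times> ?B)"
      unfolding has_sum_lists_Suc by (rule has_sum_imp_summable)
    then have "(\<lambda>p. (K * (\<Prod>x\<leftarrow>ys. norm x)) * (\<lambda>(j, js). prod_list (map (\<lambda>j. norm (z j)) (j # js))) p) 
        summable_on (J \<times> ?B)"
      by (rule summable_on_cmult_right)
    then have "(\<lambda>p. norm (?f p)) summable_on (J \<times> ?B)"
    proof (rule Infinite_Sum.abs_summable_on_comparison_test')
      fix p assume p: "p \<in> J \<times> ?B"
      obtain j js where [simp]: "p = (j, js)" by (cases p)
      have "ys @ z j # map z js \<in> lists X" "length (ys @ z j # map z js) = k"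
        using p Suc.prems by (auto intro!: z(1))
      from K[OF this] 
      show "norm (?f p) \<le> (K * (\<Prod>x\<leftarrow>ys. norm x)) * (\<lambda>(j, js). prod_list (map (\<lambda>j. norm (z j)) (j # js))) p"
        by (simp add: mult_ac o_def)
    qed
    then have "?f summable_on (J \<times> ?B)"
      by (rule abs_summable_summable)
    then have "(?f has_sum M (ys @ u # replicate l u)) (J \<times> ?B)"
      by (intro has_sum_SigmaI[OF _ outer]) (use inner in auto)
    then show ?case by (simp add: has_sum_lists_Suc)
  qed
  from this[of "[]" k] show ?thesis by simp
qed

text \<open>A telescoping argument: \<open>u\<close> is exchanged for \<open>w n\<close> slot by
  slot, and each exchange changes the value by a term with a factor \<open>norm (w n - u)\<close>.
  It makes the sets in the Baire argument closed.\<close>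

lemma bounded_multilinear_on_tendsto_replicate:
  assumes M: "bounded_multilinear_on k X Y M" and X: "subspace X"
    and w: "\<And>n. w n \<in> X" "w \<longlonglongrightarrow> u" and u: "u \<in> X"
  shows "(\<lambda>n. M (replicate k (w n))) \<longlonglongrightarrow> M (replicate k u)"
proof -
  obtain K where K: "\<And>xs. xs \<in> lists X \<Longrightarrow> length xs = k \<Longrightarrow> norm (M xs) \<le> K * (\<Prod>x\<leftarrow>xs. norm x)"
    using bounded_multilinear_on_bound[OF M] by blast
  have "(\<lambda>n. M (replicate j (w n) @ replicate (k - j) u)) \<longlonglongrightarrow> M (replicate k u)" if "j \<le> k" for j
    using that
  proof (induction j)
    case 0
    then show ?case by simp
  next
    case (Suc j)
    let ?zs = "replicate (k - Suc j) u"
    have diff: "M (replicate j (w n) @ w n # ?zs) - M (replicate j (w n) @ u # ?zs) =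
        M (replicate j (w n) @ (w n - u) # ?zs)" for n
      by (rule bounded_linear_on_diff[OF bounded_multilinear_on_slot[OF M] X, symmetric])
         (use Suc.prems w u in auto)
    have bound: "norm (M (replicate j (w n) @ (w n - u) # ?zs)) \<le>
        K * (norm (w n) ^ j * (norm (w n - u) * norm u ^ (k - Suc j)))" for n
    proof -
      have "replicate j (w n) @ (w n - u) # ?zs \<in> lists X"
        using w(1)[of n] u by (auto simp: subspace_diff[OF X] in_lists_conv_set)
      from K[OF this] show ?thesis using Suc.prems by simp
    qed
    have "(\<lambda>n. K * (norm (w n) ^ j * (norm (w n - u) * norm u ^ (k - Suc j))))
        \<longlonglongrightarrow> K * (norm u ^ j * (norm (u - u) * norm u ^ (k - Suc j)))"
      by (intro tendsto_intros w)
    then have "(\<lambda>n. K * (norm (w n) ^ j * (norm (w n - u) * norm u ^ (k - Suc j)))) \<longlonglongrightarrow> 0"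
      by simp
    then have "(\<lambda>n. M (replicate j (w n) @ (w n - u) # ?zs)) \<longlonglongrightarrow> 0"
      by (rule Lim_null_comparison[OF always_eventually[OF allI[OF bound]]])
    moreover have "(\<lambda>n. M (replicate j (w n) @ u # ?zs)) \<longlonglongrightarrow> M (replicate k u)"
    proof -
      have "replicate (k - j) u = u # ?zs"
        using Suc.prems by (metis Suc_diff_Suc Suc_le_lessD replicate_Suc)
      then show ?thesis using Suc by simp
    qed
    ultimately have "(\<lambda>n. M (replicate j (w n) @ (w n - u) # ?zs) + M (replicate j (w n) @ u # ?zs))
        \<longlonglongrightarrow> 0 + M (replicate k u)"
      by (rule tendsto_add)
    then show ?case
      by (simp add: diff[symmetric] replicate_app_Cons_same)
  qed
  from this[of k] show ?thesis by simp
qed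

subsection \<open>Symmetrization and polarization\<close>

text \<open>Permutations are encoded as the lists of positions that they visit. The factor
  \<open>1 / fact k\<close> leaves the diagonal unchanged, so symmetrized coefficients give the same
  Taylor series.\<close>

definition symmetrization :: "nat \<Rightarrow> ('a list \<Rightarrow> 'b::real_vector) \<Rightarrow> 'a list \<Rightarrow> 'b" where
  "symmetrization k M xs = (1 / fact k) *\<^sub>R (\<Sum>\<pi>\<in>permutations_of_set {..<k}. M (map ((!) xs) \<pi>))"

lemma symmetrization_replicate: "symmetrization k M (replicate k u) = M (replicate k u)"
proof -
  have "map ((!) (replicate k u)) \<pi> = replicate k u" if "\<pi> \<in> permutations_of_set {..<k}" for \<pi>
  proof -
    have "length \<pi> = k" using length_finite_permutations_of_set[OF that] by simp
    moreover have "set \<pi> = {..<k}" using permutations_of_setD(1)[OF that] .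
    ultimately show ?thesis by (intro replicate_eqI) auto
  qed
  then have "(\<Sum>\<pi>\<in>permutations_of_set {..<k}. M (map ((!) (replicate k u)) \<pi>)) = (fact k :: real) *\<^sub>R M (replicate k u)"
    by (simp add: scaleR_conv_of_real sum_constant_scaleR)
  then show ?thesis by (simp add: symmetrization_def)
qed

text \<open>The argument in slot \<open>i\<close> is used at exactly one place \<open>p\<close> of
  the permuted list, so updates go over into updates, and the product of norms sees only the
  multiset of arguments.\<close>

lemma bounded_multilinear_on_permute:
  assumes M: "bounded_multilinear_on k X Y M" and \<pi>: "\<pi> \<in> permutations_of_set {..<k}"
  shows "bounded_multilinear_on k X Y (\<lambda>xs. M (map ((!) xs) \<pi>))"
proof -
  have len: "length \<pi> = k" using length_finite_permutations_of_set[OF \<pi>] by simp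
  have set: "set \<pi> = {..<k}" and dist: "distinct \<pi>" using permutations_of_setD[OF \<pi>] by auto
  have perm: "mset (map ((!) xs) \<pi>) = mset xs" if "length xs = k" for xs :: "'a list"
  proof -
    have "mset \<pi> = mset [0..<k]"
      using set dist by (metis atLeast_upt distinct_upt mset_set_set)
    then have "mset (map ((!) xs) \<pi>) = mset (map ((!) xs) [0..<k])" by (simp only: mset_map)
    moreover have "map ((!) xs) [0..<k] = xs" using that map_nth by blast
    ultimately show ?thesis by (simp only:)
  qed
  have lists: "map ((!) xs) \<pi> \<in> lists X" if "xs \<in> lists X" "length xs = k" for xs
    using that mset_eq_setD[OF perm[OF that(2)]] by (auto simp: lists_eq_set)
  have upd: "\<exists>p<k. \<forall>x. map ((!) (xs[i := x])) \<pi> = (map ((!) xs) \<pi>)[p := x]"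
    if "length xs = k" "i < k" for xs :: "'a list" and i
  proof -
    obtain p where p: "p < k" "\<pi> ! p = i"
      using \<open>i < k\<close> set len by (metis in_set_conv_nth lessThan_iff)
    have "map ((!) (xs[i := x])) \<pi> = (map ((!) xs) \<pi>)[p := x]" for x
    proof (rule nth_equalityI)
      fix q assume "q < length (map ((!) (xs[i := x])) \<pi>)"
      then have q: "q < k" using len by simp
      then have "\<pi> ! q < k" using set len by (metis lessThan_iff nth_mem)
      moreover have "\<pi> ! q = i \<longleftrightarrow> q = p"
        using p q len dist by (metis nth_eq_iff_index_eq)
      ultimately show "map ((!) (xs[i := x])) \<pi> ! q = (map ((!) xs) \<pi>)[p := x] ! q"
        using q len that p(2) by (cases "q = p") simp_all
    qed simp
    then show ?thesis using p(1) by blast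
  qed
  obtain K where K: "\<And>xs. xs \<in> lists X \<Longrightarrow> length xs = k \<Longrightarrow> norm (M xs) \<le> K * (\<Prod>x\<leftarrow>xs. norm x)"
    using bounded_multilinear_on_bound[OF M] by blast
  have "norm (M (map ((!) xs) \<pi>)) \<le> K * (\<Prod>x\<leftarrow>xs. norm x)" if "xs \<in> lists X" "length xs = k" for xs
  proof -
    have "mset (map norm (map ((!) xs) \<pi>)) = mset (map norm xs)"
      using perm[OF that(2)] by (metis mset_map)
    then have "(\<Prod>x\<leftarrow>map ((!) xs) \<pi>. norm x) = (\<Prod>x\<leftarrow>xs. norm x)"
      by (metis prod_mset_prod_list)
    then show ?thesis using K[OF lists[OF that]] len by simp
  qed
  then have bound: "\<exists>K. \<forall>xs\<in>lists X. length xs = k \<longrightarrow> norm (M (map ((!) xs) \<pi>)) \<le> K * (\<Prod>x\<leftarrow>xs. norm x)"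
    by blast
  have "M (map ((!) (xs[i := x + y])) \<pi>) = M (map ((!) (xs[i := x])) \<pi>) + M (map ((!) (xs[i := y])) \<pi>)"
    if "xs \<in> lists X" "i < k" "x \<in> X" "y \<in> X" "length xs = k" for xs i x y
  proof -
    obtain p where p: "p < k" "\<And>x. map ((!) (xs[i := x])) \<pi> = (map ((!) xs) \<pi>)[p := x]"
      using upd[OF \<open>length xs = k\<close> \<open>i < k\<close>] by blast
    show ?thesis unfolding p(2)
      using M lists[OF that(1,5)] len p(1) that unfolding bounded_multilinear_on_def by simp
  qed
  moreover have "M (map ((!) (xs[i := a *\<^sub>R x])) \<pi>) = a *\<^sub>R M (map ((!) (xs[i := x])) \<pi>)"
    if "xs \<in> lists X" "i < k" "x \<in> X" "length xs = k" for xs i a x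
  proof -
    obtain p where p: "p < k" "\<And>x. map ((!) (xs[i := x])) \<pi> = (map ((!) xs) \<pi>)[p := x]"
      using upd[OF \<open>length xs = k\<close> \<open>i < k\<close>] by blast
    show ?thesis unfolding p(2)
      using M lists[OF that(1,4)] len p(1) that unfolding bounded_multilinear_on_def by simp
  qed
  moreover have "M (map ((!) xs) \<pi>) \<in> Y" if "xs \<in> lists X" "length xs = k" for xs
    using bounded_multilinear_on_range[OF M lists[OF that]] len by simp
  ultimately show ?thesis
    using bound unfolding bounded_multilinear_on_def by simp
qed

lemma bounded_multilinear_on_symmetrization:
  assumes "subspace Y" "bounded_multilinear_on k X Y M"
  shows "bounded_multilinear_on k X Y (symmetrization k M)"
  unfolding symmetrization_def[abs_def]
  by (rule bounded_multilinear_on_scaleR[OF assms(1)], rule bounded_multilinear_on_sum[OF assms(1)],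
      rule bounded_multilinear_on_permute[OF assms(2)])

text \<open>Inclusion-exclusion: expand the product over \<open>i\<close> in \<open>U\<close> of
  \<open>1 + b i\<close>, where \<open>b i\<close> is \<open>0\<close> on \<open>T\<close> and
  \<open>-1\<close> off \<open>T\<close>. A single index outside \<open>T\<close> makes the product
  vanish.\<close>

lemma sum_Pow_sign_superset:
  assumes U: "finite U" and TU: "T \<subseteq> U"
  shows "(\<Sum>S\<in>Pow U. if T \<subseteq> S then (-1) ^ card (U - S) else 0) = (if T = U then 1 else 0 :: real)"
proof -
  have "(\<Prod>i\<in>U. 1 + (if i \<in> T then 0 else -1 :: real)) =
      (\<Sum>S\<in>Pow U. (\<Prod>i\<in>S. 1) * (\<Prod>i\<in>U - S. if i \<in> T then 0 else -1))"
    by (rule prod_add[OF U])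
  also have "\<dots> = (\<Sum>S\<in>Pow U. if T \<subseteq> S then (-1) ^ card (U - S) else 0)"
  proof (rule sum.cong[OF refl])
    fix S assume S: "S \<in> Pow U"
    show "(\<Prod>i\<in>S. 1) * (\<Prod>i\<in>U - S. if i \<in> T then 0 else -1 :: real) =
        (if T \<subseteq> S then (-1) ^ card (U - S) else 0)"
    proof (cases "T \<subseteq> S")
      case True
      then have "(\<Prod>i\<in>U - S. if i \<in> T then 0 else -1 :: real) = (\<Prod>i\<in>U - S. -1)"
        by (intro prod.cong) auto
      then show ?thesis using True by simp
    next
      case False
      then obtain i where "i \<in> U - S" "i \<in> T" using TU by blast
      then have "(\<Prod>i\<in>U - S. if i \<in> T then 0 else -1 :: real) = 0"
        using U by (intro prod_zero) auto
      then show ?thesis using False by simp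
    qed
  qed
  also have "(\<Prod>i\<in>U. 1 + (if i \<in> T then 0 else -1 :: real)) = (if T = U then 1 else 0)"
  proof (cases "T = U")
    case False
    then obtain i where "i \<in> U" "i \<notin> T" using TU by blast
    then show ?thesis using U False by (auto intro!: prod_zero)
  qed simp
  finally show ?thesis by simp
qed

text \<open>The base point \<open>a\<close> is arbitrary, so a bound on the diagonal near any single point controls
  the symmetrization everywhere.\<close>

lemma polarization:
  fixes X :: "'a::banach set"
  assumes M: "bounded_multilinear_on k X Y M" and X: "subspace X" and a: "a \<in> X"
    and xs: "xs \<in> lists X" "length xs = k"
  shows "(\<Sum>\<pi>\<in>permutations_of_set {..<k}. M (map ((!) xs) \<pi>)) =
    (\<Sum>S\<in>Pow {..<k}. (-1) ^ card ({..<k} - S) *\<^sub>R M (replicate k (a + (\<Sum>i\<in>S. xs ! i))))"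
proof -
  \<comment> \<open>The extra index \<open>k\<close> stands for the base point, so that
    \<open>a\<close> plus the sum over \<open>S\<close> becomes a sum of \<open>z\<close> over
    \<open>insert k S\<close>.\<close>
  define z where "z = (\<lambda>i. if i < k then xs ! i else a)"
  define A where "A = {js. set js \<subseteq> {..k} \<and> length js = k}"
  let ?T = "\<lambda>js. set js \<inter> {..<k}"
  have z: "z i \<in> X" for i using xs a by (auto simp: z_def in_lists_conv_set)
  have finA: "finite A" unfolding A_def by (rule finite_lists_length_eq) simp
  have expand: "M (replicate k (a + (\<Sum>i\<in>S. xs ! i))) = (\<Sum>js\<in>A. if ?T js \<subseteq> S then M (map z js) else 0)"
    if S: "S \<subseteq> {..<k}" for S
  proof -
    have fin: "finite S" using finite_subset[OF S] by simp
    have "sum z (insert k S) = z k + sum z S" using fin S by (intro sum.insert) auto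
    also have "sum z S = (\<Sum>i\<in>S. xs ! i)" using S by (intro sum.cong) (auto simp: z_def)
    finally have sum: "sum z (insert k S) = a + (\<Sum>i\<in>S. xs ! i)" by (simp add: z_def)
    have "a + (\<Sum>i\<in>S. xs ! i) \<in> X"
      unfolding sum[symmetric] by (rule subspace_sum[OF X]) (rule z)
    moreover have "(z has_sum (a + (\<Sum>i\<in>S. xs ! i))) (insert k S)"
      using fin by (simp add: has_sum_finite_iff del: sum.insert add: sum)
    ultimately have "((\<lambda>js. M (map z js)) has_sum M (replicate k (a + (\<Sum>i\<in>S. xs ! i))))
        {js. set js \<subseteq> insert k S \<and> length js = k}"
      using fin by (intro bounded_multilinear_on_has_sum[OF M X] z) auto
    then have "M (replicate k (a + (\<Sum>i\<in>S. xs ! i))) =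
        (\<Sum>js\<in>{js. set js \<subseteq> insert k S \<and> length js = k}. M (map z js))"
      using fin by (simp add: has_sum_finite_iff finite_lists_length_eq)
    also have "{js. set js \<subseteq> insert k S \<and> length js = k} = {js\<in>A. ?T js \<subseteq> S}"
      unfolding A_def using S by fastforce
    also have "(\<Sum>js\<in>{js\<in>A. ?T js \<subseteq> S}. M (map z js)) = (\<Sum>js\<in>A. if ?T js \<subseteq> S then M (map z js) else 0)"
      by (rule sum.inter_filter[OF finA])
    finally show ?thesis .
  qed
  have "(\<Sum>S\<in>Pow {..<k}. (-1) ^ card ({..<k} - S) *\<^sub>R M (replicate k (a + (\<Sum>i\<in>S. xs ! i)))) =
      (\<Sum>S\<in>Pow {..<k}. \<Sum>js\<in>A. (if ?T js \<subseteq> S then (-1) ^ card ({..<k} - S) else 0) *\<^sub>R M (map z js))"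
    by (rule sum.cong[OF refl]) (auto simp: expand scaleR_sum_right intro!: sum.cong)
  \<comment> \<open>After the exchange of sums the signs cancel for every index list that misses
    some \<open>i < k\<close>. A list of length \<open>k\<close> hitting all of them is a
    permutation with no slot left for \<open>a\<close>, so the base point drops out.\<close>
  also have "\<dots> = (\<Sum>js\<in>A. (\<Sum>S\<in>Pow {..<k}. if ?T js \<subseteq> S then (-1) ^ card ({..<k} - S) else 0) *\<^sub>R M (map z js))"
    unfolding scaleR_sum_left by (rule sum.swap)
  also have "\<dots> = (\<Sum>js\<in>A. if ?T js = {..<k} then M (map z js) else 0)"
    by (rule sum.cong[OF refl]) (subst sum_Pow_sign_superset, auto)
  also have "\<dots> = (\<Sum>js\<in>{js\<in>A. ?T js = {..<k}}. M (map z js))"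
    by (rule sum.inter_filter[OF finA, symmetric])
  also have "\<dots> = (\<Sum>\<pi>\<in>permutations_of_set {..<k}. M (map ((!) xs) \<pi>))"
  proof (rule sum.cong)
    show "{js\<in>A. ?T js = {..<k}} = permutations_of_set {..<k}"
    proof (intro set_eqI iffI)
      fix js assume "js \<in> {js\<in>A. ?T js = {..<k}}"
      then have js: "{..<k} \<subseteq> set js" "length js = k" by (auto simp: A_def)
      then have "card (set js) \<le> card {..<k}" using card_length[of js] by simp
      then have "set js = {..<k}" using js(1) by (metis card_seteq List.finite_set)
      moreover from this have "distinct js" by (intro card_distinct) (simp add: js(2))
      ultimately show "js \<in> permutations_of_set {..<k}" by (rule permutations_of_setI)
    next
      fix js assume js: "js \<in> permutations_of_set {..<k}"
      have "set js = {..<k}" using permutations_of_setD(1)[OF js] .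
      moreover have "length js = k" using length_finite_permutations_of_set[OF js] by simp
      ultimately show "js \<in> {js\<in>A. ?T js = {..<k}}"
        unfolding A_def by (simp add: less_imp_le subset_iff)
    qed
    fix \<pi> assume "\<pi> \<in> permutations_of_set {..<k}"
    then have "map z \<pi> = map ((!) xs) \<pi>"
      by (intro map_cong) (simp_all add: z_def permutations_of_setD(1))
    then show "M (map z \<pi>) = M (map ((!) xs) \<pi>)" by (simp only:)
  qed
  finally show ?thesis by simp
qed

text \<open>A single term of the exponential series at \<open>real k\<close> is at most its
  sum.\<close>

lemma power_le_fact_mult_exp: "real k ^ k \<le> fact k * exp (real k)"
proof -
  have "(\<lambda>n. real k ^ n /\<^sub>R fact n) sums exp (real k)"
    by (rule exp_converges)
  then have "(\<Sum>n\<in>{k}. real k ^ n /\<^sub>R fact n) \<le> exp (real k)"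
    by (intro sums_le[OF _ sums_If_finite_set[of "{k}"]] sum_le_suminf) auto
  then show ?thesis by (simp add: field_simps)
qed

text \<open>Arguments are rescaled to norm at most \<open>\<rho> / (2 * k)\<close>, which keeps all
  points of the polarization formula in the ball. The constant collects \<open>2\<close> from the
  \<open>2 ^ k\<close> subsets, \<open>2 / \<rho>\<close> from undoing the rescaling, and
  \<open>exp 1\<close> from trading the remaining \<open>k ^ k\<close> for
  \<open>fact k\<close>.\<close>

lemma norm_symmetrization_le:
  fixes X :: "'a::banach set"
  assumes M: "bounded_multilinear_on k X Y M" and X: "subspace X" and Y: "subspace Y"
    and a: "a \<in> X" and \<rho>: "\<rho> > 0" and k: "k \<ge> 1"
    and B: "\<And>u. u \<in> X \<Longrightarrow> norm (u - a) < \<rho> \<Longrightarrow> norm (M (replicate k u)) \<le> fact k * N ^ k"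
    and N: "N \<ge> 0"
    and xs: "xs \<in> lists X" "length xs = k"
  shows "norm (symmetrization k M xs) \<le> fact k * (4 * exp 1 * N / \<rho>) ^ k * (\<Prod>x\<leftarrow>xs. norm x)"
proof -
  define \<delta> where "\<delta> = \<rho> / (2 * k)"
  have \<delta>: "\<delta> > 0" using \<rho> k by (simp add: \<delta>_def)
  have sym: "bounded_multilinear_on k X Y (symmetrization k M)"
    by (rule bounded_multilinear_on_symmetrization[OF Y M])
  \<comment> \<open>Zero entries stay zero, since division by zero gives \<open>0\<close>; they are
    treated separately below.\<close>
  define ys where "ys = map (\<lambda>x. (\<delta> / norm x) *\<^sub>R x) xs"
  have ys: "ys \<in> lists X" "length ys = k"
    using xs by (auto simp: ys_def intro!: subspace_scale[OF X])
  have small: "norm y \<le> \<delta>" if "y \<in> set ys" for y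
    using that \<delta> by (auto simp: ys_def)
  have "norm (M (replicate k (a + (\<Sum>i\<in>S. ys ! i)))) \<le> fact k * N ^ k" if S: "S \<subseteq> {..<k}" for S
  proof (rule B)
    have in_ys: "ys ! i \<in> set ys" if "i \<in> S" for i using that S ys(2) by auto
    then show "a + (\<Sum>i\<in>S. ys ! i) \<in> X"
      using ys(1) by (intro subspace_add[OF X a] subspace_sum[OF X]) (auto simp: in_lists_conv_set)
    have "norm (\<Sum>i\<in>S. ys ! i) \<le> real (card S) * \<delta>"
      using in_ys small by (intro order_trans[OF sum_norm_le[where g="\<lambda>_. \<delta>"]]) auto
    also have "\<dots> \<le> real k * \<delta>"
      using card_mono[OF _ S] \<delta> by (intro mult_right_mono) auto
    also have "\<dots> < \<rho>" using k \<rho> by (simp add: \<delta>_def field_simps)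
    finally show "norm (a + (\<Sum>i\<in>S. ys ! i) - a) < \<rho>" by simp
  qed
  then have "norm (\<Sum>S\<in>Pow {..<k}. (-1) ^ card ({..<k} - S) *\<^sub>R M (replicate k (a + (\<Sum>i\<in>S. ys ! i))))
      \<le> (\<Sum>S\<in>Pow {..<k}. fact k * N ^ k)"
    by (intro sum_norm_le) (auto simp: power_abs)
  also have "\<dots> = 2 ^ k * (fact k * N ^ k)" by (simp add: card_Pow)
  \<comment> \<open>The \<open>fact k\<close> of the bound cancels against the
    \<open>1 / fact k\<close> of the symmetrization; it returns below from
    \<open>k ^ k\<close>.\<close>
  finally have "norm (symmetrization k M ys) \<le> 2 ^ k * N ^ k"
    unfolding symmetrization_def polarization[OF M X a ys]
    by (simp add: field_simps)
  moreover have "symmetrization k M xs = (\<Prod>y\<leftarrow>xs. norm y / \<delta>) *\<^sub>R symmetrization k M ys"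
  proof -
    have prod: "(\<Prod>x\<leftarrow>zs. norm x / \<delta>) *\<^sub>R v = 0" if "0 \<in> set zs" for zs :: "'a list" and v :: 'a
      using that by (induction zs) auto
    show ?thesis
    proof (cases "0 \<in> set xs")
      case True
      then obtain us vs where "xs = us @ 0 # vs" by (auto simp: in_set_conv_decomp)
      then have "symmetrization k M xs = 0"
        using bounded_linear_on_zero[OF bounded_multilinear_on_slot[OF sym, of us vs] X] xs by auto
      then show ?thesis using prod[OF True] by simp
    next
      case False
      then have "(\<Prod>x\<leftarrow>xs. norm x / \<delta>) * (\<Prod>x\<leftarrow>xs. \<delta> / norm x) = 1"
        using \<delta> by (induction xs) (auto simp: field_simps)
      then show ?thesis
        unfolding ys_def bounded_multilinear_on_scale_all[OF sym X xs] by simp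
    qed
  qed
  moreover have "(\<Prod>y\<leftarrow>xs. norm y / \<delta>) = (\<Prod>x\<leftarrow>xs. norm x) / \<delta> ^ length xs"
    by (induction xs) auto
  moreover have nn: "0 \<le> (\<Prod>x\<leftarrow>xs. norm x)" by (rule prod_list_nonneg) auto
  ultimately have "norm (symmetrization k M xs) \<le> (\<Prod>x\<leftarrow>xs. norm x) / \<delta> ^ k * (2 ^ k * N ^ k)"
    using \<delta> xs(2) by (simp add: mult_left_mono divide_right_mono)
  also have "\<dots> = (\<Prod>x\<leftarrow>xs. norm x) * (real k ^ k * (4 * N / \<rho>) ^ k)"
  proof -
    have "(2 * N / \<delta>) ^ k = (real k * (4 * N / \<rho>)) ^ k"
      using k \<rho> by (intro arg_cong[of _ _ "\<lambda>x. x ^ k"]) (simp add: \<delta>_def)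
    then have "2 ^ k * N ^ k / \<delta> ^ k = real k ^ k * (4 * N / \<rho>) ^ k"
      by (simp only: power_mult_distrib power_divide)
    then show ?thesis by (metis times_divide_eq_left times_divide_eq_right)
  qed
  also have "\<dots> \<le> (\<Prod>x\<leftarrow>xs. norm x) * ((fact k * exp (real k)) * (4 * N / \<rho>) ^ k)"
    by (intro mult_left_mono[OF _ nn] mult_right_mono[OF power_le_fact_mult_exp])
       (simp add: N less_imp_le[OF \<rho>])
  also have "exp (real k) = exp 1 ^ k" by (simp add: exp_of_nat_mult[symmetric])
  finally show ?thesis by (simp add: power_mult_distrib power_divide mult_ac)
qed

subsection \<open>Geometric bounds on Taylor coefficients\<close>

text \<open>Homogeneity of the diagonal turns the bound for a small multiple of \<open>u\<close>
  into a bound of geometric growth for \<open>u\<close>, so the sets \<open>T n\<close> cover all of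
  \<open>X\<close> and not only the convergence ball. Completeness of \<open>X\<close> comes from
  its closedness.\<close>

lemma multilinear_diagonals_locally_bounded:
  fixes X :: "'a::banach set"
  assumes X: "banach_subspace X" and D: "\<And>k. k \<ge> 1 \<Longrightarrow> bounded_multilinear_on k X Y (D k)"
    and r: "r > 0"
    and pointwise: "\<And>h. h \<in> X \<Longrightarrow> norm h < r \<Longrightarrow>
      \<exists>B. \<forall>k\<ge>1. norm (D k (replicate k h)) \<le> fact k * B"
  shows "\<exists>a\<in>X. \<exists>\<rho>>0. \<exists>N\<ge>0. \<forall>u\<in>X. norm (u - a) < \<rho> \<longrightarrow>
    (\<forall>k\<ge>1. norm (D k (replicate k u)) \<le> fact k * N ^ k)"
proof -
  have sub: "subspace X" and clo: "closed X" using X by (auto simp: banach_subspace_def)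
  define T where "T n = {u\<in>X. \<forall>k\<ge>1. norm (D k (replicate k u)) \<le> fact k * real n ^ k}" for n
  have cover: "(\<Union>n. T n) = X"
  proof (intro equalityI subsetI)
    fix u assume u: "u \<in> X"
    \<comment> \<open>Scales \<open>u\<close> to norm below \<open>r\<close>; the summand
      \<open>1\<close> covers \<open>u = 0\<close>.\<close>
    define t where "t = r / (2 * (norm u + 1))"
    have n1: "norm u + 1 > 0" using norm_ge_zero[of u] by linarith
    have t: "t > 0" using r n1 by (simp add: t_def)
    have "norm (t *\<^sub>R u) = r / 2 * (norm u / (norm u + 1))" using t n1 r by (simp add: t_def field_simps)
    also have "\<dots> \<le> r / 2 * 1" using r n1 by (intro mult_left_mono) auto
    finally have "norm (t *\<^sub>R u) < r" using r by linarith
    then obtain B where B: "\<And>k. k \<ge> 1 \<Longrightarrow> norm (D k (replicate k (t *\<^sub>R u))) \<le> fact k * B"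
      using pointwise[OF subspace_scale[OF sub u]] by blast
    obtain n where n: "max 1 B / t \<le> real n" using real_arch_simple by blast
    have "norm (D k (replicate k u)) \<le> fact k * real n ^ k" if k: "k \<ge> 1" for k
    proof -
      have "D k (map (\<lambda>x. t *\<^sub>R x) (replicate k u)) = prod_list (map (\<lambda>_. t) (replicate k u)) *\<^sub>R D k (replicate k u)"
        by (rule bounded_multilinear_on_scale_all[OF D[OF k] sub]) (use u in auto)
      then have "t ^ k * norm (D k (replicate k u)) \<le> fact k * B"
        using B[OF k] t by simp
      \<comment> \<open>\<open>max 1 B\<close> is at most its \<open>k\<close>-th power because
        \<open>k\<close> is positive, so a constant bound is absorbed into a geometric one.\<close>
      also have "\<dots> \<le> fact k * max 1 B ^ k"
        using self_le_power[of "max 1 B" k] k by (intro mult_left_mono) auto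
      finally have "norm (D k (replicate k u)) \<le> fact k * (max 1 B / t) ^ k"
        using t by (simp add: power_divide field_simps)
      also have "\<dots> \<le> fact k * real n ^ k"
        using n t by (intro mult_left_mono power_mono) auto
      finally show ?thesis .
    qed
    then show "u \<in> (\<Union>n. T n)" using u by (auto simp: T_def)
  qed (auto simp: T_def)
  have closed: "closed (T n)" for n
    unfolding closed_sequential_limits
  proof (intro allI impI, elim conjE)
    fix w l assume w: "\<forall>i. w i \<in> T n" and l: "w \<longlonglongrightarrow> l"
    then have wX: "\<And>i. w i \<in> X" by (auto simp: T_def)
    then have lX: "l \<in> X" using l clo unfolding closed_sequential_limits by blast
    have "norm (D k (replicate k l)) \<le> fact k * real n ^ k" if k: "k \<ge> 1" for k
    proof (rule LIMSEQ_le_const2)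
      show "(\<lambda>i. norm (D k (replicate k (w i)))) \<longlonglongrightarrow> norm (D k (replicate k l))"
        by (intro tendsto_norm bounded_multilinear_on_tendsto_replicate[OF D[OF k] sub wX l lX])
      show "\<exists>N. \<forall>i\<ge>N. norm (D k (replicate k (w i))) \<le> fact k * real n ^ k"
        using w k by (auto simp: T_def)
    qed
    then show "l \<in> T n" using lX by (simp add: T_def)
  qed
  \<comment> \<open>Otherwise \<open>X\<close> would have empty interior relative to itself, yet it
    contains \<open>0\<close>.\<close>
  have "\<exists>n. top_of_set X interior_of T n \<noteq> {}"
  proof (rule ccontr)
    assume "\<nexists>n. top_of_set X interior_of T n \<noteq> {}"
    then have "top_of_set X interior_of \<Union>(range T) = {}"
      using clo closed
      by (intro Baire_category_alt disjI1 completely_metrizable_space_closedin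
            completely_metrizable_space_euclidean)
         (auto intro!: closed_subset simp: T_def)
    then have "X = {}" using interior_of_topspace[of "top_of_set X"] cover by simp
    then show False using subspace_0[OF sub] by simp
  qed
  then obtain n a W where W: "openin (top_of_set X) W" "a \<in> W" "W \<subseteq> T n"
    by (auto simp: interior_of_def)
  then obtain \<rho> where \<rho>: "\<rho> > 0" "ball a \<rho> \<inter> X \<subseteq> W" and a: "a \<in> X"
    unfolding openin_contains_ball by blast
  have "u \<in> T n" if "u \<in> X" "norm (u - a) < \<rho>" for u
    using that \<rho> W(3) by (auto simp: dist_norm norm_minus_commute)
  then show ?thesis using a \<rho>(1) by (intro bexI[of _ a] exI[of _ \<rho>] conjI exI[of _ "real n"]) (auto simp: T_def)
qed

text \<open>Terms of a convergent series are bounded, which supplies the pointwise hypothesis of the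
  Baire argument. \<open>C\<close> does not depend on \<open>k\<close> because the ball found there
  serves all degrees at once.\<close>

lemma spectral_taylor_symmetric_coefficients:
  fixes X :: "'a::banach set"
  assumes X: "banach_subspace X" and Y: "subspace Y" and F: "has_spectral_taylor X Y F A D"
  shows "has_spectral_taylor X Y F A (\<lambda>k. symmetrization k (D k))"
    and "\<exists>C\<ge>0. \<forall>k\<ge>1. \<forall>xs\<in>lists X. length xs = k \<longrightarrow>
      norm (symmetrization k (D k) xs) \<le> fact k * C ^ k * (\<Prod>x\<leftarrow>xs. norm x)"
proof -
  have D: "\<And>k. k \<ge> 1 \<Longrightarrow> bounded_multilinear_on k X Y (D k)"
    using F by (simp add: has_spectral_taylor_def)
  have sub: "subspace X" using X by (simp add: banach_subspace_def)
  show "has_spectral_taylor X Y F A (\<lambda>k. symmetrization k (D k))"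
    using F bounded_multilinear_on_symmetrization[OF Y D]
    unfolding has_spectral_taylor_def symmetrization_replicate by simp
  obtain r where r: "r > 0" and conv: "\<And>h. h \<in> X \<Longrightarrow> norm h < r \<Longrightarrow>
      (\<lambda>k. (1 / fact (Suc k)) *\<^sub>R D (Suc k) (replicate (Suc k) h)) sums (F (A + h) - F A)"
    using F unfolding has_spectral_taylor_def by blast
  have "\<exists>B. \<forall>k\<ge>1. norm (D k (replicate k h)) \<le> fact k * B" if "h \<in> X" "norm h < r" for h
  proof -
    have "Bseq (\<lambda>k. (1 / fact (Suc k)) *\<^sub>R D (Suc k) (replicate (Suc k) h))"
      using conv[OF that] sums_summable summable_LIMSEQ_zero convergentI convergent_imp_Bseq by blast
    then obtain B where B: "\<And>k. norm ((1 / fact (Suc k)) *\<^sub>R D (Suc k) (replicate (Suc k) h)) \<le> B"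
      unfolding Bseq_def by blast
    have "norm (D k (replicate k h)) \<le> fact k * B" if "k \<ge> 1" for k
    proof -
      obtain j where "k = Suc j" using \<open>k \<ge> 1\<close> by (cases k) auto
      then have "norm (D k (replicate k h)) / fact k \<le> B" using B[of j] by simp
      then show ?thesis by (simp add: divide_le_eq mult.commute)
    qed
    then show ?thesis by blast
  qed
  from multilinear_diagonals_locally_bounded[OF X D r this]
  obtain a \<rho> N where a: "a \<in> X" and \<rho>: "\<rho> > 0" and N: "N \<ge> 0"
    and B: "\<And>u k. u \<in> X \<Longrightarrow> norm (u - a) < \<rho> \<Longrightarrow> k \<ge> 1 \<Longrightarrow>
      norm (D k (replicate k u)) \<le> fact k * N ^ k"
    by blast
  have "norm (symmetrization k (D k) xs) \<le> fact k * (4 * exp 1 * N / \<rho>) ^ k * (\<Prod>x\<leftarrow>xs. norm x)"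
    if "k \<ge> 1" "xs \<in> lists X" "length xs = k" for k xs
    using norm_symmetrization_le[OF D[OF that(1)] sub Y a \<rho> that(1) B N] that by blast
  then show "\<exists>C\<ge>0. \<forall>k\<ge>1. \<forall>xs\<in>lists X. length xs = k \<longrightarrow>
      norm (symmetrization k (D k) xs) \<le> fact k * C ^ k * (\<Prod>x\<leftarrow>xs. norm x)"
    using N \<rho> by (intro exI[of _ "4 * exp 1 * N / \<rho>"]) auto
qed

subsection \<open>Composition of Taylor expansions\<close>

text \<open>The tensor product of the maps \<open>P k\<close>, for \<open>k\<close> in
  \<open>ks\<close>, on consecutive blocks of arguments. No averaging over assignments of arguments
  to blocks is made: a Taylor series sees only the diagonal, where all assignments agree.\<close>

primrec block_values :: "(nat \<Rightarrow> 'a list \<Rightarrow> 'b) \<Rightarrow> nat list \<Rightarrow> 'a list \<Rightarrow> 'b list" where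
  "block_values P [] xs = []"
| "block_values P (k # ks) xs = P k (take k xs) # block_values P ks (drop k xs)"

lemma length_block_values [simp]: "length (block_values P ks xs) = length ks"
  by (induction ks arbitrary: xs) auto

lemma block_values_replicate:
  "block_values P ks (replicate (sum_list ks) h) = map (\<lambda>k. P k (replicate k h)) ks"
  by (induction ks) auto

lemma block_values_in_lists:
  assumes "\<And>k xs. k \<in> set ks \<Longrightarrow> xs \<in> lists X \<Longrightarrow> length xs = k \<Longrightarrow> P k xs \<in> Y"
    and "xs \<in> lists X" "length xs = sum_list ks"
  shows "block_values P ks xs \<in> lists Y"
  using assms
proof (induction ks arbitrary: xs)
  case (Cons k ks)
  have "take k xs \<in> lists X" "drop k xs \<in> lists X"
    using Cons.prems(2) by (auto simp: in_lists_conv_set dest: in_set_takeD in_set_dropD)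
  then show ?case using Cons by simp
qed simp

lemma norm_block_values_le:
  assumes "\<And>k xs. k \<in> set ks \<Longrightarrow> xs \<in> lists X \<Longrightarrow> length xs = k \<Longrightarrow>
      norm (P k xs) \<le> C ^ k * (\<Prod>x\<leftarrow>xs. norm x)"
    and "xs \<in> lists X" "length xs = sum_list ks" and C: "C \<ge> 0"
  shows "(\<Prod>y\<leftarrow>block_values P ks xs. norm y) \<le> C ^ sum_list ks * (\<Prod>x\<leftarrow>xs. norm x)"
  using assms(1-3)
proof (induction ks arbitrary: xs)
  case (Cons k ks)
  have lists: "take k xs \<in> lists X" "drop k xs \<in> lists X"
    using Cons.prems(2) by (auto simp: in_lists_conv_set dest: in_set_takeD in_set_dropD)
  have nn: "0 \<le> (\<Prod>x\<leftarrow>zs. norm x)" for zs :: "'c::real_normed_vector list"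
    by (rule prod_list_nonneg) auto
  have "norm (P k (take k xs)) \<le> C ^ k * (\<Prod>x\<leftarrow>take k xs. norm x)"
    using Cons.prems lists by simp
  moreover have "(\<Prod>y\<leftarrow>block_values P ks (drop k xs). norm y) \<le> C ^ sum_list ks * (\<Prod>x\<leftarrow>drop k xs. norm x)"
    by (rule Cons.IH) (use Cons.prems lists in auto)
  ultimately have "(\<Prod>y\<leftarrow>block_values P (k # ks) xs. norm y) \<le>
      (C ^ k * (\<Prod>x\<leftarrow>take k xs. norm x)) * (C ^ sum_list ks * (\<Prod>x\<leftarrow>drop k xs. norm x))"
    unfolding block_values.simps list.map prod_list.Cons
    by (rule mult_mono) (intro mult_nonneg_nonneg zero_le_power C nn)+
  also have "\<dots> = C ^ sum_list (k # ks) * (\<Prod>x\<leftarrow>take k xs @ drop k xs. norm x)"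
    unfolding map_append prod_list.append by (simp add: power_add mult_ac)
  finally show ?case by simp
qed simp

text \<open>Slot \<open>i\<close> lies in exactly one block, so \<open>x\<close> enters only through
  the \<open>P k\<close> of that block; \<open>w\<close>, \<open>ys\<close> and \<open>zs\<close>
  are chosen before \<open>x\<close>, as multilinearity requires.\<close>

lemma block_values_update:
  assumes "i < sum_list ks" "length xs = sum_list ks"
  shows "\<exists>k\<in>set ks. \<exists>j<k. \<exists>w ys zs. length w = k \<and> set w \<subseteq> set xs \<and>
    (\<forall>x. block_values P ks (xs[i := x]) = ys @ P k (w[j := x]) # zs)"
  using assms
proof (induction ks arbitrary: xs i)
  case (Cons k ks)
  show ?case
  proof (cases "i < k")
    case True
    have "block_values P (k # ks) (xs[i := x]) =
        [] @ P k ((take k xs)[i := x]) # block_values P ks (drop k xs)" for x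
      using True by (simp add: take_update_swap)
    moreover have "length (take k xs) = k" "set (take k xs) \<subseteq> set xs"
      using Cons.prems by (auto dest: in_set_takeD)
    ultimately show ?thesis using True by (intro bexI[of _ k]) (blast, simp)
  next
    case False
    have "\<exists>k'\<in>set ks. \<exists>j<k'. \<exists>w ys zs. length w = k' \<and> set w \<subseteq> set (drop k xs) \<and>
        (\<forall>x. block_values P ks ((drop k xs)[i - k := x]) = ys @ P k' (w[j := x]) # zs)"
      by (rule Cons.IH) (use Cons.prems False in auto)
    then obtain k' j w ys zs where *: "k' \<in> set ks" "j < k'" "length w = k'" "set w \<subseteq> set (drop k xs)"
      "\<And>x. block_values P ks ((drop k xs)[i - k := x]) = ys @ P k' (w[j := x]) # zs"
      by blast
    have "block_values P (k # ks) (xs[i := x]) = (P k (take k xs) # ys) @ P k' (w[j := x]) # zs" for x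
      using False *(5)[of x] by (simp add: drop_update_swap)
    moreover have "set w \<subseteq> set xs" using *(4) set_drop_subset[of k xs] by blast
    ultimately show ?thesis using *(1-3) by (intro bexI[of _ k']) (blast, simp)
  qed
qed simp

lemma bounded_multilinear_on_block_values:
  assumes Q: "bounded_multilinear_on (length ks) Y Z Q"
    and P: "\<And>k. k \<in> set ks \<Longrightarrow> bounded_multilinear_on k X Y (P k)"
    and bound: "\<And>k xs. k \<in> set ks \<Longrightarrow> xs \<in> lists X \<Longrightarrow> length xs = k \<Longrightarrow>
      norm (P k xs) \<le> C ^ k * (\<Prod>x\<leftarrow>xs. norm x)" and C: "C \<ge> 0"
  shows "bounded_multilinear_on (sum_list ks) X Z (\<lambda>xs. Q (block_values P ks xs))"
proof -
  have lists: "block_values P ks xs \<in> lists Y" if "xs \<in> lists X" "length xs = sum_list ks" for xs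
    using bounded_multilinear_on_range[OF P] that by (intro block_values_in_lists) auto
  obtain K where K: "K \<ge> 0" "\<And>xs. xs \<in> lists Y \<Longrightarrow> length xs = length ks \<Longrightarrow> norm (Q xs) \<le> K * (\<Prod>x\<leftarrow>xs. norm x)"
    using bounded_multilinear_on_bound[OF Q] by blast
  have "norm (Q (block_values P ks xs)) \<le> (K * C ^ sum_list ks) * (\<Prod>x\<leftarrow>xs. norm x)"
    if "xs \<in> lists X" "length xs = sum_list ks" for xs
  proof -
    have "norm (Q (block_values P ks xs)) \<le> K * (\<Prod>y\<leftarrow>block_values P ks xs. norm y)"
      by (rule K(2)[OF lists[OF that]]) simp
    also have "\<dots> \<le> K * (C ^ sum_list ks * (\<Prod>x\<leftarrow>xs. norm x))"
      by (rule mult_left_mono[OF norm_block_values_le[OF bound that C] K(1)])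
    finally show ?thesis by (simp add: mult.assoc)
  qed
  then have bound': "\<exists>K. \<forall>xs\<in>lists X. length xs = sum_list ks \<longrightarrow>
      norm (Q (block_values P ks xs)) \<le> K * (\<Prod>x\<leftarrow>xs. norm x)"
    by blast
  \<comment> \<open>Reduces both multilinearity conditions to a single block: \<open>T\<close> is
    \<open>Q\<close> with every other block value frozen.\<close>
  have slot: "\<exists>T k j w. k \<in> set ks \<and> j < k \<and> w \<in> lists X \<and> length w = k \<and> bounded_linear_on Y Z T \<and>
      (\<forall>x. Q (block_values P ks (xs[i := x])) = T (P k (w[j := x])))"
    if xs: "xs \<in> lists X" "length xs = sum_list ks" "i < sum_list ks" for xs i
  proof -
    obtain k j w ys zs where *: "k \<in> set ks" "j < k" "length w = k" "set w \<subseteq> set xs"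
      "\<And>x. block_values P ks (xs[i := x]) = ys @ P k (w[j := x]) # zs"
      using block_values_update[OF xs(3,2)] by blast
    have "xs[i := xs ! i] = xs" by simp
    then have eq: "block_values P ks xs = ys @ P k (w[j := xs ! i]) # zs" using *(5)[of "xs ! i"] by simp
    then have "ys \<in> lists Y" "zs \<in> lists Y" using lists[OF xs(1,2)] by auto
    moreover have "length ys + Suc (length zs) = length ks"
      using arg_cong[OF eq, of length] by simp
    ultimately have "bounded_linear_on Y Z (\<lambda>y. Q (ys @ y # zs))"
      by (rule bounded_multilinear_on_slot[OF Q])
    then show ?thesis
      using * xs(1)
      by (intro exI[of _ "\<lambda>y. Q (ys @ y # zs)"] exI[of _ k] exI[of _ j] exI[of _ w])
         (auto simp: in_lists_conv_set)
  qed
  have upd: "w[j := x] \<in> lists X" if "w \<in> lists X" "x \<in> X" for w j x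
    using that set_update_subset_insert[of w j x] by (auto simp: in_lists_conv_set)
  have "Q (block_values P ks (xs[i := x + y])) = Q (block_values P ks (xs[i := x])) + Q (block_values P ks (xs[i := y]))"
    if "xs \<in> lists X" "i < sum_list ks" "x \<in> X" "y \<in> X" "length xs = sum_list ks" for xs i x y
  proof -
    obtain T k j w where *: "k \<in> set ks" "j < k" "w \<in> lists X" "length w = k" "bounded_linear_on Y Z T"
      "\<And>x. Q (block_values P ks (xs[i := x])) = T (P k (w[j := x]))"
      using slot[OF \<open>xs \<in> lists X\<close> \<open>length xs = sum_list ks\<close> \<open>i < sum_list ks\<close>] by blast
    have "P k (w[j := x + y]) = P k (w[j := x]) + P k (w[j := y])"
      using P[OF *(1)] *(2-4) that unfolding bounded_multilinear_on_def by simp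
    moreover have "P k (w[j := x]) \<in> Y" "P k (w[j := y]) \<in> Y"
      using bounded_multilinear_on_range[OF P[OF *(1)] upd[OF *(3)]] *(4) that by simp_all
    ultimately show ?thesis
      using *(5) unfolding *(6) bounded_linear_on_def by simp
  qed
  moreover have "Q (block_values P ks (xs[i := a *\<^sub>R x])) = a *\<^sub>R Q (block_values P ks (xs[i := x]))"
    if "xs \<in> lists X" "i < sum_list ks" "x \<in> X" "length xs = sum_list ks" for xs i a x
  proof -
    obtain T k j w where *: "k \<in> set ks" "j < k" "w \<in> lists X" "length w = k" "bounded_linear_on Y Z T"
      "\<And>x. Q (block_values P ks (xs[i := x])) = T (P k (w[j := x]))"
      using slot[OF \<open>xs \<in> lists X\<close> \<open>length xs = sum_list ks\<close> \<open>i < sum_list ks\<close>] by blast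
    have "P k (w[j := a *\<^sub>R x]) = a *\<^sub>R P k (w[j := x])"
      using P[OF *(1)] *(2-4) that unfolding bounded_multilinear_on_def by simp
    moreover have "P k (w[j := x]) \<in> Y"
      using bounded_multilinear_on_range[OF P[OF *(1)] upd[OF *(3)]] *(4) that by simp
    ultimately show ?thesis
      using *(5) unfolding *(6) bounded_linear_on_def by simp
  qed
  moreover have "Q (block_values P ks xs) \<in> Z" if "xs \<in> lists X" "length xs = sum_list ks" for xs
    by (rule bounded_multilinear_on_range[OF Q lists[OF that]]) simp
  ultimately show ?thesis
    using bound' unfolding bounded_multilinear_on_def by simp
qed

text \<open>Compositions in the combinatorial sense. Order matters because each list of degrees
  occurs separately when the series are multiplied out.\<close>

definition compositions :: "nat \<Rightarrow> nat list set" where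
  "compositions n = {ks. set ks \<subseteq> {1..} \<and> sum_list ks = n}"

lemma finite_compositions: "finite (compositions n)"
proof -
  have "set ks \<subseteq> {..n} \<and> length ks \<le> n" if "ks \<in> compositions n" for ks
  proof -
    have "length ks \<le> sum_list ks" if "set ks \<subseteq> {1..}" for ks :: "nat list"
      using that by (induction ks) auto
    then show ?thesis using that by (auto simp: compositions_def dest: member_le_sum_list)
  qed
  then have "compositions n \<subseteq> {ks. set ks \<subseteq> {..n} \<and> length ks \<le> n}" by blast
  then show ?thesis by (rule finite_subset) (simp add: finite_lists_length_le)
qed

lemma compositions_1: "compositions 1 = {[1]}"
proof -
  have "ks = [1]" if "set ks \<subseteq> {1..}" "sum_list ks = 1" for ks :: "nat list"
    using that by (cases ks rule: list.exhaust; cases "tl ks" rule: list.exhaust) auto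
  then show ?thesis by (auto simp: compositions_def)
qed

text \<open>
  With \<open>P k = D k / k!\<close> and \<open>Q m = E m / m!\<close>, inserting \<open>u = \<Sum>k. P k [h, \<dots>, h]\<close> into
  \<open>\<Sum>m. Q m [u, \<dots>, u]\<close> and expanding gives one term \<open>Q m [P k\<^sub>1 [h, \<dots>], \<dots>, P k\<^sub>m [h, \<dots>]]\<close> for
  each list \<open>ks\<close> of positive numbers; it has degree \<open>sum_list ks\<close> in \<open>h\<close>.
\<close>

definition compose_coefficients ::
  "(nat \<Rightarrow> 'b list \<Rightarrow> 'c::real_vector) \<Rightarrow> (nat \<Rightarrow> 'a list \<Rightarrow> 'b::real_vector) \<Rightarrow> nat \<Rightarrow> 'a list \<Rightarrow> 'c" where
  "compose_coefficients E D n xs = fact n *\<^sub>R (\<Sum>ks\<in>compositions n.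
     (1 / fact (length ks)) *\<^sub>R E (length ks) (block_values (\<lambda>k xs. (1 / fact k) *\<^sub>R D k xs) ks xs))"

text \<open>The chain rule on the level of coefficients: the only composition of \<open>1\<close> is
  \<open>[1]\<close>.\<close>

lemma compose_coefficients_1: "compose_coefficients E D 1 [h] = E 1 [D 1 [h]]"
  by (simp add: compose_coefficients_def compositions_1[unfolded One_nat_def])

text \<open>Regroups a summable family along a partition of its index set; it is applied twice to
  the same family, by list length and by list sum.\<close>

lemma has_sum_disjoint_UN:
  fixes f :: "'i \<Rightarrow> 'a::banach"
  assumes f: "f summable_on A" and A: "A = (\<Union>m\<in>I. B m)" and disj: "disjoint_family_on B I"
    and B: "\<And>m. m \<in> I \<Longrightarrow> (f has_sum g m) (B m)"
  shows "(g has_sum infsum f A) I"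
proof -
  have "inj_on snd (Sigma I B)"
    using disj by (force simp: inj_on_def disjoint_family_on_def)
  moreover have "snd ` Sigma I B = A" by (force simp: A)
  ultimately have "(f \<circ> snd has_sum infsum f A) (Sigma I B)"
    using has_sum_reindex[of snd "Sigma I B" f] has_sum_infsum[OF f] by simp
  then show ?thesis
    by (rule has_sum_Sigma[OF isUCont_plus]) (simp add: B)
qed

text \<open>Passes between degrees counted from \<open>1\<close> and the shifted summation index of
  \<open>has_spectral_taylor\<close>.\<close>

lemma has_sum_atLeast_1_iff: "(f has_sum s) {1..} \<longleftrightarrow> ((\<lambda>k. f (Suc k)) has_sum s) UNIV"
proof -
  have "Suc ` UNIV = {1..}"
    by (auto simp: image_iff dest: Suc_le_D)
  then show ?thesis
    using has_sum_reindex[of Suc UNIV f s] by (simp add: o_def)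
qed

text \<open>The geometric bounds are hypotheses on the coefficients at hand, since they may fail
  before symmetrization.\<close>

lemma has_spectral_taylor_compose:
  fixes X Y Z :: "'a::banach set"
  assumes X: "subspace X" and Y: "subspace Y" and Z: "subspace Z"
    and F_in: "F \<in> X \<rightarrow> Y" and A: "A \<in> X"
    and F: "has_spectral_taylor X Y F A D" and G: "has_spectral_taylor Y Z G (F A) E"
    and C: "C \<ge> 0" "\<And>k xs. k \<ge> 1 \<Longrightarrow> xs \<in> lists X \<Longrightarrow> length xs = k \<Longrightarrow>
      norm (D k xs) \<le> fact k * C ^ k * (\<Prod>x\<leftarrow>xs. norm x)"
    and C': "C' \<ge> 0" "\<And>k ys. k \<ge> 1 \<Longrightarrow> ys \<in> lists Y \<Longrightarrow> length ys = k \<Longrightarrow>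
      norm (E k ys) \<le> fact k * C' ^ k * (\<Prod>y\<leftarrow>ys. norm y)"
  shows "has_spectral_taylor X Z (G \<circ> F) A (compose_coefficients E D)"
proof -
  define P where "P = (\<lambda>k xs. (1 / fact k :: real) *\<^sub>R D k xs)"
  define Q where "Q = (\<lambda>k ys. (1 / fact k :: real) *\<^sub>R E k ys)"
  have P: "bounded_multilinear_on k X Y (P k)" if "k \<ge> 1" for k
    unfolding P_def using F that
    by (intro bounded_multilinear_on_scaleR[OF Y]) (simp add: has_spectral_taylor_def)
  have Q: "bounded_multilinear_on k Y Z (Q k)" if "k \<ge> 1" for k
    unfolding Q_def using G that
    by (intro bounded_multilinear_on_scaleR[OF Z]) (simp add: has_spectral_taylor_def)
  have P_le: "norm (P k xs) \<le> C ^ k * (\<Prod>x\<leftarrow>xs. norm x)" if "k \<ge> 1" "xs \<in> lists X" "length xs = k" for k xs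
    using C(2)[OF that] by (simp add: P_def divide_le_eq mult_ac)
  have Q_le: "norm (Q k xs) \<le> C' ^ k * (\<Prod>x\<leftarrow>xs. norm x)" if "k \<ge> 1" "xs \<in> lists Y" "length xs = k" for k xs
    using C'(2)[OF that] by (simp add: Q_def divide_le_eq mult_ac)
  have R: "compose_coefficients E D n xs =
      fact n *\<^sub>R (\<Sum>ks\<in>compositions n. Q (length ks) (block_values P ks xs))" for n xs
    by (simp add: compose_coefficients_def P_def Q_def)
  have multilinear: "bounded_multilinear_on n X Z (compose_coefficients E D n)" if n: "n \<ge> 1" for n
  proof -
    have "bounded_multilinear_on n X Z (\<lambda>xs. Q (length ks) (block_values P ks xs))"
      if ks: "ks \<in> compositions n" for ks
    proof -
      have "1 \<le> length ks" and ks1: "\<And>k. k \<in> set ks \<Longrightarrow> 1 \<le> k" and sum: "sum_list ks = n"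
        using ks n by (cases ks; auto simp: compositions_def)+
      then have "bounded_multilinear_on (sum_list ks) X Z (\<lambda>xs. Q (length ks) (block_values P ks xs))"
        using bounded_multilinear_on_block_values[OF Q P P_le C(1)] by blast
      then show ?thesis using sum by simp
    qed
    then have "bounded_multilinear_on n X Z (\<lambda>xs. \<Sum>ks\<in>compositions n. Q (length ks) (block_values P ks xs))"
      by (rule bounded_multilinear_on_sum[OF Z])
    then show ?thesis
      unfolding R[abs_def] by (rule bounded_multilinear_on_scaleR[OF Z])
  qed
  obtain r where r: "r > 0" and F_sums: "\<And>h. h \<in> X \<Longrightarrow> norm h < r \<Longrightarrow>
      (\<lambda>k. P (Suc k) (replicate (Suc k) h)) sums (F (A + h) - F A)"
    using F unfolding has_spectral_taylor_def P_def by blast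
  obtain r' where r': "r' > 0" and G_sums: "\<And>u. u \<in> Y \<Longrightarrow> norm u < r' \<Longrightarrow>
      (\<lambda>k. Q (Suc k) (replicate (Suc k) u)) sums (G (F A + u) - G (F A))"
    using G unfolding has_spectral_taylor_def Q_def by blast
  \<comment> \<open>The three bounds on \<open>q = C * norm h\<close> serve in turn to give
    \<open>q / (1 - q) \<le> 2 * q\<close>, to keep \<open>u\<close> within the radius
    \<open>r'\<close> of \<open>G\<close>, and to make \<open>s < 1\<close>. Adding \<open>1\<close>
    to \<open>C'\<close>, and to \<open>C\<close> in \<open>\<delta>\<close>, avoids division by
    zero.\<close>
  define \<eta> where "\<eta> = min (1 / 2) (min (r' / 2) (1 / (2 * (C' + 1))))"
  define \<delta> where "\<delta> = min r (\<eta> / (C + 1))"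
  have \<eta>: "\<eta> > 0" using r' C' by (simp add: \<eta>_def)
  have \<delta>: "\<delta> > 0" using \<eta> r C by (simp add: \<delta>_def)
  have "(\<lambda>n. (1 / fact (Suc n)) *\<^sub>R compose_coefficients E D (Suc n) (replicate (Suc n) h))
      sums ((G \<circ> F) (A + h) - (G \<circ> F) A)" if h: "h \<in> X" "norm h < \<delta>" for h
  proof -
    define q where "q = C * norm h"
    define v where "v = (\<lambda>k. P k (replicate k h))"
    define u where "u = F (A + h) - F A"
    define f where "f = (\<lambda>ks. Q (length ks) (map v ks))"
    have q0: "q \<ge> 0" using C by (simp add: q_def)
    have "q \<le> (C + 1) * norm h" by (simp add: q_def algebra_simps)
    also have "\<dots> < (C + 1) * (\<eta> / (C + 1))"
      using h(2) C by (intro mult_strict_left_mono) (auto simp: \<delta>_def)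
    also have "\<dots> = \<eta>" using C by simp
    finally have q: "q < \<eta>" .
    then have q_half: "q < 1 / 2" by (simp add: \<eta>_def)
    have uY: "u \<in> Y"
      using F_in A subspace_add[OF X A h(1)] unfolding u_def by (intro subspace_diff[OF Y]) auto
    have vY: "v k \<in> Y" if "k \<in> {1..}" for k
      unfolding v_def using that h by (intro bounded_multilinear_on_range[OF P]) auto
    have v_le: "norm (v k) \<le> q ^ k" if "k \<in> {1..}" for k
    proof -
      have "replicate k h \<in> lists X" using h by (simp add: in_lists_conv_set)
      then show ?thesis
        using P_le[of k "replicate k h"] that by (simp add: v_def q_def power_mult_distrib)
    qed
    have "(\<lambda>k. q * q ^ k) sums (q * (1 / (1 - q)))"
      using q0 q_half by (intro sums_mult geometric_sums) auto
    then have geo: "((\<lambda>k. q ^ k) has_sum (q / (1 - q))) {1..}"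
      unfolding has_sum_atLeast_1_iff using q0 by (intro sums_nonneg_imp_has_sum) auto
    have norm_v: "(\<lambda>k. norm (v k)) summable_on {1..}"
      by (rule Infinite_Sum.abs_summable_on_comparison_test'[OF has_sum_imp_summable[OF geo] v_le])
    have v_sum: "(v has_sum u) {1..}"
    proof -
      have "v summable_on {1..}" using norm_v by (rule abs_summable_summable)
      then obtain s where s: "(v has_sum s) {1..}" by (auto simp: summable_on_def)
      then have "(\<lambda>k. v (Suc k)) sums s"
        unfolding has_sum_atLeast_1_iff by (rule has_sum_imp_sums)
      moreover have "(\<lambda>k. v (Suc k)) sums u"
        unfolding v_def u_def using h by (intro F_sums) (auto simp: \<delta>_def)
      ultimately show ?thesis using s sums_unique2 by blast
    qed
    have "norm u \<le> q / (1 - q)"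
    proof (rule norm_sums_le)
      show "(\<lambda>k. v (Suc k)) sums u"
        unfolding v_def u_def using h by (intro F_sums) (auto simp: \<delta>_def)
      show "(\<lambda>k. q ^ Suc k) sums (q / (1 - q))"
        using geo unfolding has_sum_atLeast_1_iff by (rule has_sum_imp_sums)
    qed (rule v_le, simp)
    also have q2: "q / (1 - q) \<le> 2 * q"
    proof -
      have "q * 1 \<le> q * (2 * (1 - q))" using q0 q_half by (intro mult_left_mono) auto
      then show ?thesis using q_half by (simp add: divide_le_eq algebra_simps)
    qed
    also have "2 * q < r'" using q by (simp add: \<eta>_def)
    finally have u_small: "norm u < r'" .
    \<comment> \<open>\<open>q / (1 - q)\<close> bounds the sum of all \<open>norm (v k)\<close>, so
      \<open>s ^ m\<close> bounds the total norm of the terms whose list has length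
      \<open>m\<close>.\<close>
    define s where "s = C' * (q / (1 - q))"
    have s0: "s \<ge> 0" using C' q0 q_half by (simp add: s_def)
    have s1: "s < 1"
    proof -
      have "s \<le> C' * (2 * q)" unfolding s_def by (rule mult_left_mono[OF q2 C'(1)])
      also have "\<dots> \<le> (C' + 1) * (2 * q)" using q0 by (intro mult_right_mono) auto
      also have "\<dots> < (C' + 1) * (2 * (1 / (2 * (C' + 1))))"
        using q C' by (intro mult_strict_left_mono) (auto simp: \<eta>_def)
      also have "\<dots> = 1" using C' by simp
      finally show ?thesis .
    qed
    let ?L = "\<lambda>m. {ks :: nat list. set ks \<subseteq> {1..} \<and> length ks = m}"
    \<comment> \<open>The index set of the fully expanded double series: all nonempty lists of
      positive degrees.\<close>
    define LS where "LS = (\<Union>m\<in>{1..}. ?L m)"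
    have fin_bound: "((\<lambda>ks. prod_list (map (\<lambda>k. C' * q ^ k) ks)) has_sum s ^ m) (?L m)" for m
      unfolding s_def using C' q0 by (intro has_sum_prod_list has_sum_cmult_right[OF geo]) auto
    have "(\<lambda>m. s ^ m) summable_on {1..}"
    proof -
      have "(\<lambda>k. s ^ Suc k) sums (s * (1 / (1 - s)))"
        unfolding power_Suc using s0 s1 by (intro sums_mult geometric_sums) auto
      then have "((\<lambda>m. s ^ m) has_sum (s * (1 / (1 - s)))) {1..}"
        unfolding has_sum_atLeast_1_iff using s0 by (intro sums_nonneg_imp_has_sum) auto
      then show ?thesis by (rule has_sum_imp_summable)
    qed
    then have "(\<lambda>ks. prod_list (map (\<lambda>k. C' * q ^ k) ks)) summable_on LS"
      unfolding LS_def using C' q0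
      by (intro summable_on_UnionI[OF fin_bound])
         (auto simp: disjoint_family_on_def intro!: prod_list_nonneg)
    then have "(\<lambda>ks. norm (f ks)) summable_on LS"
    proof (rule Infinite_Sum.abs_summable_on_comparison_test')
      fix ks assume "ks \<in> LS"
      then have ks: "set ks \<subseteq> {1..}" "length ks \<ge> 1" by (auto simp: LS_def)
      have "norm (f ks) \<le> C' ^ length ks * (\<Prod>y\<leftarrow>map v ks. norm y)"
      proof -
        have "map v ks \<in> lists Y" using ks(1) vY by (fastforce simp: in_lists_conv_set)
        then show ?thesis unfolding f_def using Q_le[OF ks(2), of "map v ks"] by simp
      qed
      also have "\<dots> \<le> prod_list (map (\<lambda>k. C' * q ^ k) ks)"
        using ks(1)
      proof (induction ks)
        case (Cons k ks)
        have "(C' * norm (v k)) * (C' ^ length ks * (\<Prod>y\<leftarrow>map v ks. norm y)) \<le>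
            (C' * q ^ k) * prod_list (map (\<lambda>k. C' * q ^ k) ks)"
        proof (rule mult_mono)
          show "C' * norm (v k) \<le> C' * q ^ k"
            using v_le[of k] Cons.prems C'(1) by (intro mult_left_mono) auto
          show "C' ^ length ks * (\<Prod>y\<leftarrow>map v ks. norm y) \<le> prod_list (map (\<lambda>k. C' * q ^ k) ks)"
            using Cons by simp
          show "0 \<le> C' * q ^ k" using C'(1) q0 by simp
          have "0 \<le> (\<Prod>y\<leftarrow>map v ks. norm y)" by (rule prod_list_nonneg) auto
          then show "0 \<le> C' ^ length ks * (\<Prod>y\<leftarrow>map v ks. norm y)" using C'(1) by simp
        qed
        then show ?case by (simp add: mult_ac)
      qed simp
      finally show "norm (f ks) \<le> prod_list (map (\<lambda>k. C' * q ^ k) ks)" .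
    qed
    then have f: "f summable_on LS" by (rule abs_summable_summable)
    \<comment> \<open>Grouping by length undoes the expansion inside each outer term and returns the
      series of \<open>G\<close> at \<open>u\<close>.\<close>
    have by_length: "((\<lambda>m. Q m (replicate m u)) has_sum infsum f LS) {1..}"
    proof (rule has_sum_disjoint_UN[OF f LS_def])
      show "disjoint_family_on ?L {1..}" by (auto simp: disjoint_family_on_def)
      fix m :: nat assume m: "m \<in> {1..}"
      then have "((\<lambda>ks. Q m (map v ks)) has_sum Q m (replicate m u)) (?L m)"
        by (intro bounded_multilinear_on_has_sum[OF Q Y uY vY v_sum norm_v]) auto
      then show "(f has_sum Q m (replicate m u)) (?L m)"
        by (rule has_sum_cong[THEN iffD1, rotated]) (auto simp: f_def)
    qed
    \<comment> \<open>Grouping by sum collects the terms of equal degree in \<open>h\<close>; a list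
      of positive numbers is nonempty exactly when its sum is positive.\<close>
    have by_sum: "((\<lambda>n. \<Sum>ks\<in>compositions n. f ks) has_sum infsum f LS) {1..}"
    proof (rule has_sum_disjoint_UN[OF f])
      have "set ks \<subseteq> {1..} \<Longrightarrow> sum_list ks \<ge> 1 \<longleftrightarrow> length ks \<ge> 1" for ks :: "nat list"
        by (cases ks) auto
      then show "LS = (\<Union>n\<in>{1..}. compositions n)" by (auto simp: LS_def compositions_def)
      show "disjoint_family_on compositions {1..}"
        by (auto simp: disjoint_family_on_def compositions_def)
      show "(f has_sum (\<Sum>ks\<in>compositions n. f ks)) (compositions n)" for n
        using finite_compositions by (simp add: has_sum_finite)
    qed
    have coeff: "(1 / fact n) *\<^sub>R compose_coefficients E D n (replicate n h) = (\<Sum>ks\<in>compositions n. f ks)" for n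
      unfolding R f_def v_def
      by (simp, rule sum.cong) (auto simp: compositions_def block_values_replicate)
    have "infsum f LS = G (F A + u) - G (F A)"
      using has_sum_imp_sums[OF by_length[unfolded has_sum_atLeast_1_iff]] G_sums[OF uY u_small]
      by (rule sums_unique2)
    then show ?thesis
      using has_sum_imp_sums[OF by_sum[unfolded has_sum_atLeast_1_iff]]
      unfolding coeff by (simp add: u_def)
  qed
  then show ?thesis
    unfolding has_spectral_taylor_def using multilinear \<delta> by blast
qed

subsection \<open>The first-order coefficient and the chain rule\<close>

text \<open>The difference quotients involve \<open>F\<close> alone, so all expansions share the
  same first-order coefficient on \<open>X\<close>.\<close>

lemma has_spectral_taylor_directional_derivative:
  fixes X :: "'a::banach set"
  assumes X: "subspace X" and F: "has_spectral_taylor X Y F A D" and h: "h \<in> X"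
  shows "((\<lambda>t. (1 / t) *\<^sub>R (F (A + t *\<^sub>R h) - F A)) \<longlongrightarrow> D 1 [h]) (at_right 0)"
proof -
  obtain r where r: "r > 0" and conv: "\<And>h. h \<in> X \<Longrightarrow> norm h < r \<Longrightarrow>
      (\<lambda>k. (1 / fact (Suc k)) *\<^sub>R D (Suc k) (replicate (Suc k) h)) sums (F (A + h) - F A)"
    using F unfolding has_spectral_taylor_def by blast
  have D: "bounded_multilinear_on (Suc k) X Y (D (Suc k))" for k
    using F by (simp add: has_spectral_taylor_def)
  define a where "a = (\<lambda>k. (1 / fact (Suc k)) *\<^sub>R D (Suc k) (replicate (Suc k) h))"
  \<comment> \<open>At \<open>t = T\<close> the series still converges, so its terms are bounded
    there; for smaller \<open>t\<close> they then decay geometrically with ratio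
    \<open>t / T\<close>.\<close>
  define T where "T = r / (2 * (norm h + 1))"
  have n1: "norm h + 1 > 0" using norm_ge_zero[of h] by linarith
  have T: "T > 0" using r n1 by (simp add: T_def)
  have sums: "(\<lambda>k. t ^ Suc k *\<^sub>R a k) sums (F (A + t *\<^sub>R h) - F A)" if t: "0 < t" "t \<le> T" for t
  proof -
    have "norm (t *\<^sub>R h) \<le> T * (norm h + 1)"
      using t by (simp add: mult_mono)
    also have "\<dots> = r / 2" using n1 by (simp add: T_def field_simps)
    also have "\<dots> < r" using r by simp
    finally have "(\<lambda>k. (1 / fact (Suc k)) *\<^sub>R D (Suc k) (replicate (Suc k) (t *\<^sub>R h))) sums (F (A + t *\<^sub>R h) - F A)"
      by (intro conv subspace_scale[OF X h])
    moreover have "D (Suc k) (replicate (Suc k) (t *\<^sub>R h)) = t ^ Suc k *\<^sub>R D (Suc k) (replicate (Suc k) h)" for k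
      using bounded_multilinear_on_scale_all[OF D X, of "replicate (Suc k) h" k "\<lambda>_. t"] h
      by (simp add: in_lists_conv_set)
    ultimately show ?thesis by (simp only: a_def scaleR_left_commute)
  qed
  have "Bseq (\<lambda>k. T ^ Suc k *\<^sub>R a k)"
    using sums[of T] T sums_summable summable_LIMSEQ_zero convergentI convergent_imp_Bseq by blast
  then obtain B where B: "B > 0" "\<And>k. norm (T ^ Suc k *\<^sub>R a k) \<le> B"
    unfolding Bseq_def by blast
  have "\<forall>\<^sub>F t in at_right 0. t \<in> {0<..<T}"
    by (rule eventually_at_right_real[OF T])
  then have bound: "\<forall>\<^sub>F t in at_right 0. norm ((1 / t) *\<^sub>R (F (A + t *\<^sub>R h) - F A) - a 0) \<le> B / T * (t / T) / (1 - t / T)"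
  proof eventually_elim
    case (elim t)
    then have t: "0 < t" "t < T" by auto
    have "(\<lambda>k. (1 / t) *\<^sub>R (t ^ Suc k *\<^sub>R a k)) sums ((1 / t) *\<^sub>R (F (A + t *\<^sub>R h) - F A))"
      using sums[of t] t by (intro sums_scaleR_right) auto
    \<comment> \<open>The leading term is written as \<open>t ^ 0 *\<^sub>R a 0\<close> so that the
      index shift can split it off.\<close>
    then have "(\<lambda>k. t ^ k *\<^sub>R a k) sums ((1 / t) *\<^sub>R (F (A + t *\<^sub>R h) - F A) - a 0 + t ^ 0 *\<^sub>R a 0)"
      using t by simp
    then have S: "(\<lambda>k. t ^ Suc k *\<^sub>R a (Suc k)) sums ((1 / t) *\<^sub>R (F (A + t *\<^sub>R h) - F A) - a 0)"
      by (subst sums_Suc_iff)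
    have "(\<lambda>k. B / T * (t / T) * (t / T) ^ k) sums (B / T * (t / T) * (1 / (1 - t / T)))"
      using t by (intro sums_mult geometric_sums) auto
    then have "norm ((1 / t) *\<^sub>R (F (A + t *\<^sub>R h) - F A) - a 0) \<le> B / T * (t / T) * (1 / (1 - t / T))"
    proof (rule norm_sums_le[OF S])
      fix k
      have "norm (a (Suc k)) \<le> B / T ^ Suc (Suc k)"
        using B(2)[of "Suc k"] T by (simp add: pos_le_divide_eq mult.commute del: power_Suc)
      then have "t ^ Suc k * norm (a (Suc k)) \<le> t ^ Suc k * (B / T ^ Suc (Suc k))"
        using t by (intro mult_left_mono) auto
      then show "norm (t ^ Suc k *\<^sub>R a (Suc k)) \<le> B / T * (t / T) * (t / T) ^ k"
        using t by (simp add: power_divide mult_ac)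
    qed
    then show ?case by simp
  qed
  have "((\<lambda>t. B / T * (t / T) / (1 - t / T)) \<longlongrightarrow> B / T * (0 / T) / (1 - 0 / T)) (at_right 0)"
    using T by (intro tendsto_intros) auto
  then have "((\<lambda>t. B / T * (t / T) / (1 - t / T)) \<longlongrightarrow> 0) (at_right 0)"
    by simp
  then have "((\<lambda>t. (1 / t) *\<^sub>R (F (A + t *\<^sub>R h) - F A) - a 0) \<longlongrightarrow> 0) (at_right 0)"
    by (rule Lim_null_comparison[OF bound])
  then have "((\<lambda>t. (1 / t) *\<^sub>R (F (A + t *\<^sub>R h) - F A)) \<longlongrightarrow> a 0) (at_right 0)"
    by (rule LIM_zero_cancel)
  then show ?thesis by (simp add: a_def)
qed

lemma spec_deriv_eq:
  fixes X :: "'a::banach set"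
  assumes "subspace X" "has_spectral_taylor X Y F A D" "h \<in> X"
  shows "spec_deriv X Y F A h = D 1 [h]"
  unfolding spec_deriv_def
proof (rule the_equality)
  show "\<exists>D'. has_spectral_taylor X Y F A D' \<and> D 1 [h] = D' 1 [h]" using assms by blast
  fix y assume "\<exists>D'. has_spectral_taylor X Y F A D' \<and> y = D' 1 [h]"
  then obtain D' where D': "has_spectral_taylor X Y F A D'" "y = D' 1 [h]" by blast
  show "y = D 1 [h]"
    unfolding D'(2)
    by (rule tendsto_unique[OF trivial_limit_at_right_real
          has_spectral_taylor_directional_derivative[OF assms(1) D'(1) assms(3)]
          has_spectral_taylor_directional_derivative[OF assms]])
qed

text \<open>Completeness is asked of \<open>X\<close> and \<open>Y\<close> because the Baire
  argument runs on the domains of the two maps. Membership of the inner derivative in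
  \<open>Y\<close> is what gives meaning to the value of the outer one there.\<close>

lemma spectral_chain_rule:
  fixes X Y Z :: "'a::banach set"
  assumes X: "banach_subspace X" and Y: "banach_subspace Y" and Z: "subspace Z"
    and F_in: "F \<in> X \<rightarrow> Y" and A: "A \<in> X"
    and F: "spectrally_analytic_at X Y F A" and G: "spectrally_analytic_at Y Z G (F A)"
  shows "spectrally_analytic_at X Z (G \<circ> F) A"
    and "h \<in> X \<Longrightarrow> spec_deriv X Y F A h \<in> Y"
    and "h \<in> X \<Longrightarrow> spec_deriv X Z (G \<circ> F) A h = spec_deriv Y Z G (F A) (spec_deriv X Y F A h)"
proof -
  have sub: "subspace X" "subspace Y" using X Y by (auto simp: banach_subspace_def)
  obtain D E where "has_spectral_taylor X Y F A D" "has_spectral_taylor Y Z G (F A) E"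
    using F G by (auto simp: spectrally_analytic_at_def)
  note D = spectral_taylor_symmetric_coefficients[OF X sub(2) this(1)]
    and E = spectral_taylor_symmetric_coefficients[OF Y Z this(2)]
  let ?D = "\<lambda>k. symmetrization k (D k)" and ?E = "\<lambda>k. symmetrization k (E k)"
  obtain C where C: "C \<ge> 0" "\<And>k xs. k \<ge> 1 \<Longrightarrow> xs \<in> lists X \<Longrightarrow> length xs = k \<Longrightarrow>
      norm (?D k xs) \<le> fact k * C ^ k * (\<Prod>x\<leftarrow>xs. norm x)"
    using D(2) by auto
  obtain C' where C': "C' \<ge> 0" "\<And>k xs. k \<ge> 1 \<Longrightarrow> xs \<in> lists Y \<Longrightarrow> length xs = k \<Longrightarrow>
      norm (?E k xs) \<le> fact k * C' ^ k * (\<Prod>x\<leftarrow>xs. norm x)"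
    using E(2) by auto
  have comp: "has_spectral_taylor X Z (G \<circ> F) A (compose_coefficients ?E ?D)"
    by (rule has_spectral_taylor_compose[OF sub Z F_in A D(1) E(1) C C'])
  then show "spectrally_analytic_at X Z (G \<circ> F) A"
    by (auto simp: spectrally_analytic_at_def)
  assume h: "h \<in> X"
  have "?D 1 [h] \<in> Y"
    using D(1) h by (intro bounded_multilinear_on_range[of 1 X Y]) (auto simp: has_spectral_taylor_def)
  then show "spec_deriv X Y F A h \<in> Y"
      "spec_deriv X Z (G \<circ> F) A h = spec_deriv Y Z G (F A) (spec_deriv X Y F A h)"
    using spec_deriv_eq[OF sub(1) D(1) h] spec_deriv_eq[OF sub(1) comp h] spec_deriv_eq[OF sub(2) E(1)]
    by (simp_all add: compose_coefficients_1 del: One_nat_def)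
qed

text \<open>The empty composition, where the induction over layers starts.\<close>

lemma has_spectral_taylor_id:
  assumes "subspace X"
  shows "has_spectral_taylor X X id A (\<lambda>k xs. if k = 1 then hd xs else 0)"
proof -
  have "bounded_multilinear_on k X X (\<lambda>xs. if k = 1 then hd xs else 0)" for k
  proof (cases "k = 1")
    case True
    have "norm (hd xs) \<le> 1 * (\<Prod>x\<leftarrow>xs. norm x)" if "length xs = 1" for xs :: "'a list"
      using that by (cases xs) auto
    then have "\<exists>K. \<forall>xs\<in>lists X. length xs = 1 \<longrightarrow> norm (hd xs) \<le> K * (\<Prod>x\<leftarrow>xs. norm x)" by blast
    then show ?thesis
      using True by (auto simp: bounded_multilinear_on_def length_Suc_conv)
  next
    case False
    then show ?thesis
      using subspace_0[OF assms] by (auto simp: bounded_multilinear_on_def intro!: exI[of _ 0])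
  qed
  moreover have "(\<lambda>k. (1 / fact (Suc k)) *\<^sub>R (if Suc k = 1 then hd (replicate (Suc k) h) else 0)) sums (id (A + h) - id A)" for h
  proof -
    have "(\<lambda>k. (1 / fact (Suc k)) *\<^sub>R (if Suc k = 1 then hd (replicate (Suc k) h) else 0)) =
        (\<lambda>k. if k = 0 then h else 0)"
      by auto
    then show ?thesis using sums_single[of 0 "\<lambda>_. h"] by simp
  qed
  ultimately show ?thesis
    unfolding has_spectral_taylor_def using zero_less_one by blast
qed

text \<open>The supremum is taken in the reals, so boundedness of \<open>T\<close> is what makes it
  an upper bound. At \<open>x = 0\<close> the quotient is \<open>0\<close> by convention.\<close>

lemma norm_div_le_onorm_on:
  assumes "bounded_linear_on X Y T" "x \<in> X"
  shows "norm (T x) / norm x \<le> onorm_on X T"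
proof -
  obtain K where K: "K \<ge> 0" "\<And>x. x \<in> X \<Longrightarrow> norm (T x) \<le> K * norm x"
    using bounded_linear_on_bound[OF assms(1)] by blast
  have "norm (T x) / norm x \<le> K" if "x \<in> X" for x
    using K(1) K(2)[OF that] by (cases "x = 0") (auto simp: divide_le_eq)
  then have "bdd_above ((\<lambda>x. norm (T x) / norm x) ` X)" by (intro bdd_aboveI2)
  then show ?thesis unfolding onorm_on_def by (rule cSUP_upper[OF assms(2)])
qed

section \<open>Contraction estimate for the layered network\<close>

theorem theorem6:
  fixes eval_net :: "'net \<Rightarrow> 'a::banach \<Rightarrow> 'a"
    and residue :: "'net \<Rightarrow> 'net \<Rightarrow> 'r::real_normed_vector"
    and N :: 'net and layer :: "nat \<Rightarrow> 'net" and L :: nat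
    and X :: "nat \<Rightarrow> 'a set"
    and F :: "nat \<Rightarrow> 'a \<Rightarrow> 'a" and A :: "nat \<Rightarrow> 'a" and A_in :: 'a
    and S :: "nat \<Rightarrow> 'a \<Rightarrow> 'a" and c :: "nat \<Rightarrow> real"
    and F_N S_N :: "'a \<Rightarrow> 'a"
  assumes decomposition: "layerwise_decomposition eval_net X N layer L"
    and F: "\<forall>l\<in>{1..L}. F l = eval_net (layer l)"
    and A_in: "A_in \<in> X 0"
    and A_0: "A 0 = A_in"
    and A: "\<forall>l\<in>{1..L}. A l = F l (A (l - 1))"
    and analytic: "\<forall>l\<in>{1..L}. spectrally_analytic_at (X (l - 1)) (X l) (F l) (A (l - 1))"
    and S: "\<forall>l\<in>{1..L}. S l = spec_deriv (X (l - 1)) (X l) (F l) (A (l - 1))"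
    and bounded: "\<forall>l\<in>{1..L}. bounded_linear_on (X (l - 1)) (X l) (S l)"
    and c_less_1: "\<forall>l\<in>{1..L}. c l < 1"
    and norm_S: "\<forall>l\<in>{1..L}. onorm_on (X (l - 1)) (S l) \<le> c l"
    and residues: "(\<Sum>l\<in>{1..<L}. ennreal (norm (residue (layer l) (layer (l + 1))))) < \<infinity>"
    and F_N: "F_N = layer_comp F L"
    and S_N: "S_N = spec_deriv (X 0) (X L) F_N (A 0)"
  shows "onorm_on (X 0) S_N \<le> (\<Prod>l\<in>{1..L}. c l) \<and>
         (\<forall>C<1. (\<forall>l\<in>{1..L}. c l \<le> C) \<longrightarrow>
            (\<forall>dA_in\<in>X 0. \<forall>dA_out. dA_out = S_N dA_in \<longrightarrow>
               norm dA_out \<le> C ^ L * norm dA_in))"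
proof -
  have X: "banach_subspace (X l)" if "l \<le> L" for l
    using decomposition that by (simp add: layerwise_decomposition_def)
  then have sub: "subspace (X l)" if "l \<le> L" for l
    using that by (simp add: banach_subspace_def)
  have F_in: "F l \<in> X (l - 1) \<rightarrow> X l" if "l \<in> {1..L}" for l
    using decomposition F that by (simp add: layerwise_decomposition_def)
  have S_le: "norm (S l x) / norm x \<le> c l" if "l \<in> {1..L}" "x \<in> X (l - 1)" for l x
    using norm_div_le_onorm_on[of "X (l - 1)" "X l" "S l" x] bounded norm_S that by force
  \<comment> \<open>At \<open>x = 0\<close> the quotient is \<open>0\<close>, so the norm bound
    forces \<open>c l\<close> to be nonnegative even on a trivial state space.\<close>
  have c_nonneg: "0 \<le> c l" if "l \<in> {1..L}" for l
  proof -
    have "l - 1 \<le> L" using that by auto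
    then show ?thesis using S_le[OF that subspace_0[OF sub]] by simp
  qed
  have S_bound: "norm (S l x) \<le> c l * norm x" if "l \<in> {1..L}" "x \<in> X (l - 1)" for l x
  proof (cases "x = 0")
    case True
    have "l - 1 \<le> L" using that by auto
    then show ?thesis
      using bounded_linear_on_zero[OF bspec[OF bounded that(1)] sub] True by simp
  next
    case False
    then show ?thesis using S_le[OF that] by (simp add: divide_le_eq)
  qed
  let ?G = "layer_comp F"
  \<comment> \<open>Range, base point and analyticity are carried along because the chain rule at
    the next layer needs them; the norm bound alone would not be inductive.\<close>
  have main: "?G n \<in> X 0 \<rightarrow> X n \<and> ?G n (A 0) = A n \<and>
      spectrally_analytic_at (X 0) (X n) (?G n) (A 0) \<and>
      (\<forall>h\<in>X 0. norm (spec_deriv (X 0) (X n) (?G n) (A 0) h) \<le> (\<Prod>l\<in>{1..n}. c l) * norm h)"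
    if "n \<le> L" for n
    using that
  proof (induction n)
    case 0
    have id: "has_spectral_taylor (X 0) (X 0) id (A 0) (\<lambda>k xs. if k = 1 then hd xs else 0)"
      using has_spectral_taylor_id sub by blast
    then have "spectrally_analytic_at (X 0) (X 0) id (A 0)"
      unfolding spectrally_analytic_at_def by blast
    moreover have "spec_deriv (X 0) (X 0) id (A 0) h = h" if "h \<in> X 0" for h
      using spec_deriv_eq[OF sub id that] by simp
    ultimately show ?case by (simp add: id_def)
  next
    case (Suc n)
    then have n: "n \<le> L" "Suc n \<in> {1..L}" by auto
    note IH = Suc.IH[OF n(1)]
    have A_n: "A 0 \<in> X 0" using A_in A_0 by simp
    have an: "spectrally_analytic_at (X n) (X (Suc n)) (F (Suc n)) (?G n (A 0))"
      using analytic n(2) IH by force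
    note chain = spectral_chain_rule[of "X 0" "X n" "X (Suc n)" "?G n" "A 0" "F (Suc n)",
        OF X X sub _ A_n _ an]
    have "norm (spec_deriv (X 0) (X (Suc n)) (?G (Suc n)) (A 0) h) \<le> (\<Prod>l\<in>{1..Suc n}. c l) * norm h"
      if h: "h \<in> X 0" for h
    proof -
      let ?y = "spec_deriv (X 0) (X n) (?G n) (A 0) h"
      have y: "?y \<in> X n" using chain(2) IH n h by simp
      have "spec_deriv (X 0) (X (Suc n)) (?G (Suc n)) (A 0) h = S (Suc n) ?y"
        using chain(3) IH n h S by simp
      also have "norm \<dots> \<le> c (Suc n) * norm ?y"
        using S_bound[OF n(2)] y by simp
      also have "\<dots> \<le> c (Suc n) * ((\<Prod>l\<in>{1..n}. c l) * norm h)"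
        using IH h c_nonneg[OF n(2)] by (intro mult_left_mono) auto
      finally show ?thesis by (simp add: mult_ac)
    qed
    moreover have "?G (Suc n) \<in> X 0 \<rightarrow> X (Suc n)" using IH F_in[OF n(2)] by auto
    moreover have "?G (Suc n) (A 0) = A (Suc n)" using IH A n(2) by simp
    moreover have "spectrally_analytic_at (X 0) (X (Suc n)) (?G (Suc n)) (A 0)"
      using chain(1) IH n by simp
    ultimately show ?case by blast
  qed
  let ?c = "\<Prod>l\<in>{1..L}. c l"
  have c: "0 \<le> ?c" by (rule prod_nonneg) (rule c_nonneg)
  have bound: "norm (S_N h) \<le> ?c * norm h" if "h \<in> X 0" for h
    using main[of L] that by (simp add: S_N F_N)
  have "onorm_on (X 0) S_N \<le> ?c"
    unfolding onorm_on_def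
  proof (rule cSUP_least)
    show "X 0 \<noteq> {}" using A_in by blast
    fix h assume "h \<in> X 0"
    then show "norm (S_N h) / norm h \<le> ?c"
      using bound[of h] c by (cases "h = 0") (auto simp: divide_le_eq)
  qed
  \<comment> \<open>Nonnegativity of each \<open>c l\<close> allows the products to be compared
    factor by factor; for \<open>L = 0\<close> both are \<open>1\<close>.\<close>
  moreover have "norm (S_N h) \<le> C ^ L * norm h" if "\<forall>l\<in>{1..L}. c l \<le> C" "h \<in> X 0" for C h
  proof -
    have "?c \<le> (\<Prod>l\<in>{1..L}. C)" using that(1) c_nonneg by (intro prod_mono) auto
    then have "?c * norm h \<le> C ^ L * norm h" by (intro mult_right_mono) auto
    then show ?thesis using bound[OF that(2)] by linarith
  qed
  ultimately show ?thesis by blast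
qed

end
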